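(* Let $\mathfrak g_n$ be $\mathfrak{so}_n$ or $\mathfrak{sp}_n$ ($n\ge2$, with $n$ even for $\mathfrak{sp}_n$), let $m\ge1$, and let $\mathfrak f_m=\mathfrak{so}_{2m}$ or $\mathfrak{sp}_{2m}$ respectively. Let $\nu=(\nu_1,\dots,\nu_m)$ with all $\nu_a\in\{1,\dots,n-1\}$, let $\mu\in\mathbb C^m$ be a generic weight of $\mathfrak f_m$, and put $\lambda=\mu+\nu-\kappa$ where $\kappa=(n/2,\dots,n/2)$. Then the restriction of $C(\mu)$ (defined in the context) to the subspace $\Lambda^{\nu_1}(\mathbb C^n)\otimes\cdots\otimes\Lambda^{\nu_m}(\mathbb C^n)\subset(\mathbb C^n)^{\otimes N}$ coincides with the restriction of the operator $\prod^{\longleftarrow}_{1\le a\le b\le m}G_{ab}$, where the lexicographically ordered pairs $(a,b)$ are arranged from right to left and $$G_{ab}=1+\sum_{d>0}\ \sum_{\substack{i_1,\dots,i_d\\ j_1,\dots,j_d}}\ \prod_{k=1}^d\frac{\widetilde P_{i_kj_k}}{\lambda_a+\lambda_b+\rho_a+\rho_b-k}\quad\text{if }a<b,$$ $$G_{aa}=1+\sum_{d>0}\ \sum_{\substack{i_1,\dots,i_d\\ j_1,\dots,j_d}}\ \prod_{k=1}^d\frac{\widetilde P_{i_kj_k}}{2(\lambda_a+\rho_a-k)}\quad\text{if }\mathfrak f_m=\mathfrak{sp}_{2m},\qquad G_{aa}=1\quad\text{if }\mathfrak f_m=\mathfrak{so}_{2m}.$$ Here, for $a<b$, the inner sum is over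 all different sets of $d$ pairs $(i_1,j_1),\dots,(i_d,j_d)$ with $i_1,\dots,i_d$ distinct numbers from the $a$th segment and $j_1,\dots,j_d$ distinct numbers from the $b$th segment of $1,\dots,N$; for $a=b$, it is over all different sets of $d$ unordered pairs $\{i_1,j_1\},\dots,\{i_d,j_d\}$ with $i_1,j_1,\dots,i_d,j_d$ pairwise distinct numbers from the $a$th segment (each set being counted once).
   Context: Let $e_1,\dots,e_n$ be the standard basis of $\mathbb C^n$, $\tilde\imath=n-i+1$, $\theta_i=-1$ if $\mathfrak g_n=\mathfrak{sp}_n$ and $i>n/2$, $\theta_i=1$ otherwise. The form on $\mathbb C^n$ is $\langle e_i,e_j\rangle=\theta_i\delta_{\tilde\imath j}$, and conjugation relative to it is $\widetilde E_{ij}=\theta_i\theta_jE_{\tilde\jmath\,\tilde\imath}$ on matrix units. Weights of $\mathfrak f_m$ are identified with their label sequences in $\mathbb C^m$. $\rho_a=-a$ if $\mathfrak f_m=\mathfrak{sp}_{2m}$ and $\rho_a=1-a$ if $\mathfrak f_m=\mathfrak{so}_{2m}$. $\mu$ is generic if $\mu_a-\mu_b\notin\mathbb Z$ and $\mu_a+\mu_b\notin\mathbb Z$ whenever $a\ne b$, and $2\mu_a\notin\mathbb Z$ for all $a$. Put $N=\nu_1+\dots+\nu_m$ and split $1,\dots,N$ into consecutive segments of lengths $\nu_1,\dots,\nu_m$. For the $i$th element $p=\nu_1+\dots+\nu_{a-1}+i$ of the $a$th segment put $x_p=\mu_a+\rho_a+\frac12+\nu_a-i$. Let $\widetilde P=\sum_{i,j}\widetilde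 E_{ij}\otimes E_{ji}$ on $\mathbb C^n\otimes\mathbb C^n$ (it is symmetric under exchanging the two tensor factors) and $\widetilde R(x)=1-\widetilde P\,x^{-1}$; subscripts $pq$ mean acting in the $p$th and $q$th tensor factors of $(\mathbb C^n)^{\otimes N}$. Put $$C(\mu)=\prod_{(p,q)}^{\longleftarrow}\widetilde R_{pq}(n-x_p-x_q),$$ the product over all $1\le p<q\le N$, with the lexicographically ordered pairs arranged from right to left. The subspace $\Lambda^{\nu_1}(\mathbb C^n)\otimes\cdots\otimes\Lambda^{\nu_m}(\mathbb C^n)$ consists of tensors antisymmetric within each segment. *)

theory Defs
  imports Complex_Main "HOL-Library.FuncSet"
begin

text \<open>The two series of dual pairs: \<open>Orth\<close> is $(so_n, so_{2m})$ and
  \<open>Symp\<close> is $(sp_n, sp_{2m})$.\<close>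

datatype series = Orth | Symp

text \<open>All indices are 1-based: basis vectors of $C^n$ by $\{1..n\}$, tensor factors by
  $\{1..N\}$, segments by $\{1..m\}$.\<close>

definition tld :: "nat \<Rightarrow> nat \<Rightarrow> nat" where
  "tld n i = n + 1 - i"

definition theta :: "series \<Rightarrow> nat \<Rightarrow> nat \<Rightarrow> complex" where
  "theta s n i = (if s = Symp \<and> 2 * i > n then - 1 else 1)"

text \<open>An $n \times n$ matrix is given by its entries.\<close>

type_synonym cmat = "nat \<Rightarrow> nat \<Rightarrow> complex"

definition E_unit :: "nat \<Rightarrow> nat \<Rightarrow> cmat" where
  "E_unit i j = (\<lambda>k l. if k = i \<and> l = j then 1 else 0)"

definition E_conj :: "series \<Rightarrow> nat \<Rightarrow> nat \<Rightarrow> nat \<Rightarrow> cmat" where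
  "E_conj s n i j = (\<lambda>k l. theta s n i * theta s n j * E_unit (tld n j) (tld n i) k l)"

definition form :: "series \<Rightarrow> nat \<Rightarrow> nat \<Rightarrow> nat \<Rightarrow> complex" where
  "form s n i j = (if tld n i = j then theta s n i else 0)"

text \<open>\<open>E_conj\<close> is the conjugate of \<open>E_unit\<close> with respect to the bilinear form
  \<open>\<langle>e\<^sub>i, e\<^sub>j\<rangle> = form i j\<close>: \<open>\<langle>E\<^sub>i\<^sub>j e\<^sub>k, e\<^sub>l\<rangle>\<close> equals
  \<open>\<langle>e\<^sub>k, E_conj\<^sub>i\<^sub>j e\<^sub>l\<rangle>\<close>.\<close>

lemma E_conj_adjoint:
  assumes "i \<in> {1..n}" "j \<in> {1..n}" "k \<in> {1..n}" "l \<in> {1..n}"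
  shows "(\<Sum>r=1..n. E_unit i j r k * form s n r l) = (\<Sum>r=1..n. E_conj s n i j r l * form s n k r)"
proof -
  have "(\<Sum>r=1..n. E_unit i j r k * form s n r l)
      = (\<Sum>r=1..n. if r = i then (if k = j then form s n i l else 0) else 0)"
    by (rule sum.cong) (auto simp: E_unit_def)
  moreover have "(\<Sum>r=1..n. E_conj s n i j r l * form s n k r)
      = (\<Sum>r=1..n. if r = tld n j then
          (if l = tld n i then theta s n i * theta s n j * form s n k (tld n j) else 0) else 0)"
    by (rule sum.cong) (auto simp: E_unit_def E_conj_def)
  ultimately show ?thesis
    using assms by (auto simp: form_def tld_def theta_def)
qed

text \<open>An element of the $N$th tensor power of $C^n$ is given by its coordinates: the
  coordinate at a multi-index $I$ is the coefficient of the tensor product of the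
  $e_{I(p)}$, $p = 1, \dots, N$.\<close>

type_synonym tensor = "(nat \<Rightarrow> nat) \<Rightarrow> complex"

definition tensor_space :: "nat \<Rightarrow> nat \<Rightarrow> tensor set" where
  "tensor_space n N = {T. \<forall>I. I \<notin> {1..N} \<rightarrow>\<^sub>E {1..n} \<longrightarrow> T I = 0}"

text \<open>The matrix $X$ acting in the $p$th tensor factor.\<close>

definition act :: "nat \<Rightarrow> nat \<Rightarrow> cmat \<Rightarrow> tensor \<Rightarrow> tensor" where
  "act n p X T = (\<lambda>I. \<Sum>k=1..n. X (I p) k * T (I(p := k)))"

definition P_til :: "series \<Rightarrow> nat \<Rightarrow> nat \<Rightarrow> nat \<Rightarrow> tensor \<Rightarrow> tensor" where
  "P_til s n p q T = (\<lambda>I. \<Sum>i=1..n. \<Sum>j=1..n. act n p (E_conj s n i j) (act n q (E_unit j i) T) I)"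

definition R_til :: "series \<Rightarrow> nat \<Rightarrow> complex \<Rightarrow> nat \<Rightarrow> nat \<Rightarrow> tensor \<Rightarrow> tensor" where
  "R_til s n x p q T = (\<lambda>I. T I - inverse x * P_til s n p q T I)"

definition rho :: "series \<Rightarrow> nat \<Rightarrow> complex" where
  "rho s a = (case s of Symp \<Rightarrow> - of_nat a | Orth \<Rightarrow> 1 - of_nat a)"

text \<open>A weight of $f_m$ is its label sequence; only the labels at $1..m$ matter.\<close>

definition generic :: "nat \<Rightarrow> (nat \<Rightarrow> complex) \<Rightarrow> bool" where
  "generic m mu \<longleftrightarrow>
     (\<forall>a\<in>{1..m}. \<forall>b\<in>{1..m}. a \<noteq> b \<longrightarrow> mu a - mu b \<notin> \<int> \<and> mu a + mu b \<notin> \<int>) \<and>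
     (\<forall>a\<in>{1..m}. 2 * mu a \<notin> \<int>)"

definition seg_start :: "(nat \<Rightarrow> nat) \<Rightarrow> nat \<Rightarrow> nat" where
  "seg_start nu a = (\<Sum>b=1..<a. nu b)"

definition segment :: "(nat \<Rightarrow> nat) \<Rightarrow> nat \<Rightarrow> nat set" where
  "segment nu a = {seg_start nu a + 1 .. seg_start nu a + nu a}"

text \<open>The number of the segment containing $p$; see \<open>x_val_eq\<close> for the resulting
  values of \<open>x_val\<close>.\<close>

definition seg_of :: "(nat \<Rightarrow> nat) \<Rightarrow> nat \<Rightarrow> nat" where
  "seg_of nu p = (LEAST a. 1 \<le> a \<and> p \<le> seg_start nu a + nu a)"

definition x_val :: "series \<Rightarrow> (nat \<Rightarrow> nat) \<Rightarrow> (nat \<Rightarrow> complex) \<Rightarrow> nat \<Rightarrow> complex" where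
  "x_val s nu mu p =
     (let a = seg_of nu p; i = p - seg_start nu a
      in mu a + rho s a + 1 / 2 + of_nat (nu a) - of_nat i)"

lemma seg_start_Suc: "1 \<le> a \<Longrightarrow> seg_start nu (Suc a) = seg_start nu a + nu a"
  by (simp add: seg_start_def)

lemma seg_start_mono:
  assumes "a \<le> b"
  shows "seg_start nu a \<le> seg_start nu b"
  unfolding seg_start_def using assms by (intro sum_mono2) auto

lemma x_val_eq:
  assumes "1 \<le> a" "i \<in> {1..nu a}"
  shows "x_val s nu mu (seg_start nu a + i) = mu a + rho s a + 1 / 2 + of_nat (nu a) - of_nat i"
proof -
  have "seg_of nu (seg_start nu a + i) = a"
    unfolding seg_of_def
  proof (rule Least_equality)
    show "1 \<le> a \<and> seg_start nu a + i \<le> seg_start nu a + nu a"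
      using assms by simp
  next
    fix b assume b: "1 \<le> b \<and> seg_start nu a + i \<le> seg_start nu b + nu b"
    show "a \<le> b"
    proof (rule ccontr)
      assume "\<not> a \<le> b"
      then have "seg_start nu (Suc b) \<le> seg_start nu a"
        by (intro seg_start_mono) simp
      then show False
        using b assms seg_start_Suc[of b nu] by simp
    qed
  qed
  then show ?thesis
    by (simp add: x_val_def Let_def)
qed

text \<open>Since \<open>fold f [u\<^sub>1, \<dots>, u\<^sub>k] = f u\<^sub>k \<circ> \<dots> \<circ> f u\<^sub>1\<close>, folding over a list
  gives the product of operators arranged from right to left.  The list comprehensions below
  enumerate the pairs lexicographically.\<close>

definition C_op :: "series \<Rightarrow> nat \<Rightarrow> nat \<Rightarrow> (nat \<Rightarrow> nat) \<Rightarrow> (nat \<Rightarrow> complex) \<Rightarrow> tensor \<Rightarrow> tensor" where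
  "C_op s n m nu mu =
     (let N = (\<Sum>a=1..m. nu a)
      in fold (\<lambda>(p, q). R_til s n (of_nat n - x_val s nu mu p - x_val s nu mu q) p q)
           [(p, q). p \<leftarrow> [1..<N + 1], q \<leftarrow> [p + 1..<N + 1]])"

definition exterior_space :: "nat \<Rightarrow> nat \<Rightarrow> (nat \<Rightarrow> nat) \<Rightarrow> tensor set" where
  "exterior_space n m nu = {T \<in> tensor_space n (\<Sum>a=1..m. nu a).
     \<forall>a\<in>{1..m}. \<forall>p\<in>segment nu a. \<forall>q\<in>segment nu a. p \<noteq> q \<longrightarrow>
       (\<forall>I. T (I(p := I q, q := I p)) = - T I)}"

text \<open>The sets of $d$ pairwise disjoint pairs $(i, j)$ with $i$ in the $a$th and $j$ in the
  $b$th segment.  For $a < b$ the condition $i < j$ is automatic, and disjointness says that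
  all $i$ are distinct and all $j$ are distinct.  For $a = b$ each unordered pair is represented
  by $(i, j)$ with $i < j$, which is harmless by \<open>P_til_sym\<close>.\<close>

definition pair_sets :: "(nat \<Rightarrow> nat) \<Rightarrow> nat \<Rightarrow> nat \<Rightarrow> nat \<Rightarrow> (nat \<times> nat) set set" where
  "pair_sets nu a b d = {S. S \<subseteq> {(i, j) \<in> segment nu a \<times> segment nu b. i < j} \<and> card S = d \<and>
     pairwise (\<lambda>(i, j) (k, l). {i, j} \<inter> {k, l} = {}) S}"

text \<open>The product of the \<open>P_til\<close> over a set of pairwise disjoint pairs.  The factors commute
  (\<open>P_til_commute\<close>), so \<^const>\<open>Finite_Set.fold\<close> is well defined; see
  \<open>P_prod_insert\<close>.\<close>

definition P_prod :: "series \<Rightarrow> nat \<Rightarrow> (nat \<times> nat) set \<Rightarrow> tensor \<Rightarrow> tensor" where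
  "P_prod s n S T = Finite_Set.fold (\<lambda>(i, j). P_til s n i j) T S"

definition G_denom :: "series \<Rightarrow> (nat \<Rightarrow> complex) \<Rightarrow> nat \<Rightarrow> nat \<Rightarrow> nat \<Rightarrow> complex" where
  "G_denom s lam a b k =
     (if a = b then 2 * (lam a + rho s a - of_nat k)
      else lam a + lam b + rho s a + rho s b - of_nat k)"

text \<open>The sum over $d > 0$ stops at \<open>nu a\<close>, because \<open>pair_sets nu a b d\<close> is empty for
  larger $d$.\<close>

definition G_op :: "series \<Rightarrow> nat \<Rightarrow> (nat \<Rightarrow> nat) \<Rightarrow> (nat \<Rightarrow> complex) \<Rightarrow> nat \<Rightarrow> nat \<Rightarrow> tensor \<Rightarrow> tensor" where
  "G_op s n nu lam a b T =
     (if a = b \<and> s = Orth then T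
      else (\<lambda>I. T I + (\<Sum>d=1..nu a. \<Sum>S\<in>pair_sets nu a b d.
                (\<Prod>k=1..d. inverse (G_denom s lam a b k)) * P_prod s n S T I)))"

definition G_prod :: "series \<Rightarrow> nat \<Rightarrow> nat \<Rightarrow> (nat \<Rightarrow> nat) \<Rightarrow> (nat \<Rightarrow> complex) \<Rightarrow> tensor \<Rightarrow> tensor" where
  "G_prod s n m nu lam =
     fold (\<lambda>(a, b). G_op s n nu lam a b) [(a, b). a \<leftarrow> [1..<m + 1], b \<leftarrow> [a..<m + 1]]"

lemma P_til_eq:
  assumes "p \<noteq> q"
  shows "P_til s n p q T I =
    (if I p \<in> {1..n} \<and> I q = tld n (I p)
     then \<Sum>i=1..n. theta s n i * theta s n (I q) * T (I(p := tld n i, q := i)) else 0)"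
proof -
  have sum_if: "(\<Sum>i\<in>A. if b then f i else 0) = (if b then \<Sum>i\<in>A. f i else 0)"
    for A :: "nat set" and b and f :: "nat \<Rightarrow> complex"
    by simp
  have q: "act n q (E_unit j i) T J = (if J q = j then T (J(q := i)) else 0)"
    if "i \<in> {1..n}" for i j J
  proof -
    have "act n q (E_unit j i) T J = (\<Sum>k=1..n. if k = i then (if J q = j then T (J(q := i)) else 0) else 0)"
      unfolding act_def by (rule sum.cong) (auto simp: E_unit_def)
    then show ?thesis using that by simp
  qed
  have pp: "act n p (E_conj s n i j) U J =
      (if J p = tld n j then theta s n i * theta s n j * U (J(p := tld n i)) else 0)"
    if "i \<in> {1..n}" for i j U J
  proof -
    have "act n p (E_conj s n i j) U J =
        (\<Sum>k=1..n. if k = tld n i then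
          (if J p = tld n j then theta s n i * theta s n j * U (J(p := tld n i)) else 0) else 0)"
      unfolding act_def by (rule sum.cong) (auto simp: E_unit_def E_conj_def)
    then show ?thesis using that by (auto simp: tld_def)
  qed
  have "P_til s n p q T I = (\<Sum>i=1..n. \<Sum>j=1..n. if j = I q then
      (if I p = tld n (I q) then theta s n i * theta s n (I q) * T (I(p := tld n i, q := i)) else 0) else 0)"
    unfolding P_til_def using assms by (intro sum.cong refl) (auto simp: q pp)
  also have "\<dots> = (\<Sum>i=1..n. if I q \<in> {1..n} \<and> I p = tld n (I q)
      then theta s n i * theta s n (I q) * T (I(p := tld n i, q := i)) else 0)"
    by (intro sum.cong refl) auto
  also have "\<dots> = (if I q \<in> {1..n} \<and> I p = tld n (I q)
     then \<Sum>i=1..n. theta s n i * theta s n (I q) * T (I(p := tld n i, q := i)) else 0)"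
    by (rule sum_if)
  also have "(I q \<in> {1..n} \<and> I p = tld n (I q)) \<longleftrightarrow> (I p \<in> {1..n} \<and> I q = tld n (I p))"
    by (auto simp: tld_def)
  finally show ?thesis .
qed

lemma P_til_sym:
  assumes "p \<noteq> q" "s = Symp \<longrightarrow> even n"
  shows "P_til s n p q T = P_til s n q p T"
proof
  fix I
  have th: "theta s n i * theta s n j = theta s n (tld n i) * theta s n (tld n j)"
    if "i \<in> {1..n}" "j \<in> {1..n}" for i j
    using that assms(2) by (auto simp: theta_def tld_def elim!: evenE)
  have "(\<Sum>i=1..n. theta s n i * theta s n (I q) * T (I(p := tld n i, q := i)))
      = (\<Sum>i=1..n. theta s n i * theta s n (I p) * T (I(q := tld n i, p := i)))"
    if I: "I p \<in> {1..n}" "I q = tld n (I p)"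
  proof (rule sum.reindex_bij_witness[of _ "tld n" "tld n"])
    fix i assume i: "i \<in> {1..n}"
    show "theta s n (tld n i) * theta s n (I p) * T (I(q := tld n (tld n i), p := tld n i))
       = theta s n i * theta s n (I q) * T (I(p := tld n i, q := i))"
    proof -
      have "I q \<in> {1..n}" "tld n (I q) = I p" "tld n (tld n i) = i"
        using i I by (auto simp: tld_def)
      then show ?thesis
        using th[of i "I q"] i assms(1) by (simp add: fun_upd_twist)
    qed
  qed (auto simp: tld_def)
  moreover have "(I p \<in> {1..n} \<and> I q = tld n (I p)) \<longleftrightarrow> (I q \<in> {1..n} \<and> I p = tld n (I q))"
    by (auto simp: tld_def)
  ultimately show "P_til s n p q T I = P_til s n q p T I"
    using assms(1) by (simp only: P_til_eq[OF assms(1)] P_til_eq[OF assms(1)[symmetric]]) metis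
qed

lemma P_til_P_til_eq:
  assumes "i \<noteq> j" "k \<noteq> l" "{i, j} \<inter> {k, l} = {}"
  shows "P_til s n i j (P_til s n k l T) I =
    (if (I i \<in> {1..n} \<and> I j = tld n (I i)) \<and> (I k \<in> {1..n} \<and> I l = tld n (I k))
     then \<Sum>u=1..n. \<Sum>w=1..n. (theta s n u * theta s n (I j)) * (theta s n w * theta s n (I l)) *
            T (I(i := tld n u, j := u, k := tld n w, l := w))
     else 0)"
proof -
  have ne: "i \<noteq> k" "i \<noteq> l" "j \<noteq> k" "j \<noteq> l"
    using assms(3) by auto
  have inner: "P_til s n k l T (I(i := tld n u, j := u)) =
      (if I k \<in> {1..n} \<and> I l = tld n (I k)
       then \<Sum>w=1..n. theta s n w * theta s n (I l) * T (I(i := tld n u, j := u, k := tld n w, l := w))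
       else 0)" for u
    using ne ne[symmetric] by (simp only: P_til_eq[OF assms(2)] fun_upd_other not_False_eq_True)
  show ?thesis
    unfolding P_til_eq[OF assms(1), of s n "P_til s n k l T"] inner
    by (cases "I k \<in> {1..n} \<and> I l = tld n (I k)")
       (simp_all only: if_True if_False simp_thms mult_zero_right sum.neutral_const if_cancel
          sum_distrib_left mult.assoc)
qed

lemma P_til_commute:
  assumes "i \<noteq> j" "k \<noteq> l" "{i, j} \<inter> {k, l} = {}"
  shows "P_til s n i j (P_til s n k l T) = P_til s n k l (P_til s n i j T)"
proof
  fix I :: "nat \<Rightarrow> nat"
  have upd: "I(i := u, j := v, k := w, l := z) = I(k := w, l := z, i := u, j := v)" for u v w z
    using assms by (auto simp: fun_eq_iff)
  have dj: "{k, l} \<inter> {i, j} = {}"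
    using assms(3) by auto
  show "P_til s n i j (P_til s n k l T) I = P_til s n k l (P_til s n i j T) I"
    unfolding P_til_P_til_eq[OF assms] P_til_P_til_eq[OF assms(2,1) dj]
    by (subst sum.swap) (simp add: upd mult_ac conj_ac)
qed

lemma P_prod_empty: "P_prod s n {} T = T"
  by (simp add: P_prod_def)

lemma P_prod_insert:
  assumes "finite S" "(i, j) \<notin> S" "\<forall>(k, l)\<in>insert (i, j) S. k \<noteq> l"
    and "pairwise (\<lambda>(i, j) (k, l). {i, j} \<inter> {k, l} = {}) (insert (i, j) S)"
  shows "P_prod s n (insert (i, j) S) T = P_til s n i j (P_prod s n S T)"
proof -
  interpret comp_fun_commute_on "insert (i, j) S" "\<lambda>(i, j). P_til s n i j"
  proof
    fix u v assume uv: "u \<in> insert (i, j) S" "v \<in> insert (i, j) S"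
    show "(case v of (i, j) \<Rightarrow> P_til s n i j) \<circ> (case u of (i, j) \<Rightarrow> P_til s n i j)
        = (case u of (i, j) \<Rightarrow> P_til s n i j) \<circ> (case v of (i, j) \<Rightarrow> P_til s n i j)"
    proof (cases "u = v")
      case False
      obtain a b c d where eq: "u = (a, b)" "v = (c, d)"
        by (cases u, cases v)
      have "{a, b} \<inter> {c, d} = {}"
        using pairwiseD[OF assms(4) uv False] by (simp add: eq)
      moreover have "a \<noteq> b" "c \<noteq> d"
        using assms(3) uv eq by auto
      ultimately show ?thesis
        by (simp add: eq fun_eq_iff P_til_commute)
    qed simp
  qed
  show ?thesis
    unfolding P_prod_def using fold_insert[OF subset_refl assms(1,2)] by simp
qed

end

theory Submission
  imports Defs "HOL-Combinatorics.Transposition"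
begin

text \<open>The factors of \<open>C_op\<close> with disjoint index pairs commute, so they can be regrouped into
  one block for each pair of segments, in the order of \<open>G_prod\<close>, and each block into columns
  \<open>R\<^sub>p\<^sub>r\<close> with \<open>r\<close> fixed.  Everything else rests on the relation
  \<open>P\<^sub>i\<^sub>r P\<^sub>i\<^sub>u = P\<^sub>i\<^sub>r (u r)\<close> for the conjugated permutation operators, where \<open>(u r)\<close> is the
  transposition of tensor factors, which is a sign on tensors skew in \<open>u\<close> and \<open>r\<close>.
  It collapses a column to \<open>1 + d\<^sup>-\<^sup>1 (\<Sum>p. P\<^sub>p\<^sub>r)\<close>.  Applied to a sum over the matchings of the
  columns treated so far, it shows that \<open>P\<^sub>i\<^sub>r\<close> maps the term of a matching that uses \<open>i\<close> to minus
  the term in which the edge at \<open>i\<close> is replaced by \<open>(i, r)\<close>; counting the edges that could have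
  been replaced, the coefficients reproduce the sum over the matchings that may also use \<open>r\<close>.
  In a diagonal block of the orthogonal series all \<open>P\<^sub>p\<^sub>q\<close> vanish on skew tensors.\<close>

section \<open>Transpositions of tensor factors, skewness, linearity of \<open>P_til\<close>\<close>

definition flip :: "nat \<Rightarrow> nat \<Rightarrow> tensor \<Rightarrow> tensor" where
  "flip p q T = (\<lambda>I. T (I \<circ> transpose p q))"

definition skew :: "nat \<Rightarrow> nat \<Rightarrow> tensor \<Rightarrow> bool" where
  "skew p q T \<longleftrightarrow> flip p q T = (\<lambda>I. - T I)"

text \<open>Coordinates outside \<open>tensor_space\<close> have to be excluded: \<open>P_til_P_til_flip\<close> fails on them.\<close>

definition supported :: "nat \<Rightarrow> nat \<Rightarrow> tensor \<Rightarrow> bool" where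
  "supported n p T \<longleftrightarrow> (\<forall>I. T I \<noteq> 0 \<longrightarrow> I p \<in> {1..n})"

lemma comp_transpose_upd: "I \<circ> transpose p q = I(p := I q, q := I p)"
  by (auto simp: fun_eq_iff transpose_def)

lemma flip_flip: "flip p q (flip p q T) = T"
  by (simp add: flip_def comp_assoc)

lemma P_til_linear:
  "P_til s n p q (\<lambda>I. T I + c * U I) = (\<lambda>I. P_til s n p q T I + c * P_til s n p q U I)"
  unfolding P_til_def act_def
  by (simp add: sum.distrib sum_distrib_left algebra_simps)

lemma P_til_zero: "P_til s n p q (\<lambda>I. 0) = (\<lambda>I. 0)"
  by (simp add: P_til_def act_def)

lemma P_til_scale: "P_til s n p q (\<lambda>I. c * U I) = (\<lambda>I. c * P_til s n p q U I)"
  using P_til_linear[of s n p q "\<lambda>I. 0" c U] by (simp add: P_til_zero)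

lemma P_til_uminus: "P_til s n p q (\<lambda>I. - U I) = (\<lambda>I. - P_til s n p q U I)"
  using P_til_scale[of s n p q "- 1" U] by simp

lemma P_til_sum:
  "P_til s n p q (\<lambda>I. \<Sum>x\<in>A. c x * U x I) = (\<lambda>I. \<Sum>x\<in>A. c x * P_til s n p q (U x) I)"
proof (induction A rule: infinite_finite_induct)
  case (insert x A)
  then show ?case
    using P_til_linear[of s n p q "\<lambda>I. \<Sum>x\<in>A. c x * U x I" "c x" "U x"]
    by (simp add: add.commute)
qed (simp_all add: P_til_zero)

lemma transpose_neq: "i \<noteq> j \<Longrightarrow> transpose p q i \<noteq> transpose p q j"
  using inj_on_transpose[of p q UNIV] by (simp add: inj_eq)

section \<open>Relations between the conjugated permutation operators and transpositions\<close>

lemma P_til_flip: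
  assumes "i \<noteq> j"
  shows "P_til s n i j (flip p q T) = flip p q (P_til s n (transpose p q i) (transpose p q j) T)"
proof
  fix I :: "nat \<Rightarrow> nat"
  have ne: "transpose p q i \<noteq> transpose p q j"
    using assms by (rule transpose_neq)
  have "I(i := u, j := v) \<circ> transpose p q
      = (I \<circ> transpose p q)(transpose p q i := u, transpose p q j := v)" for u v
    by (auto simp: fun_eq_iff transpose_def)
  then show "P_til s n i j (flip p q T) I = flip p q (P_til s n (transpose p q i) (transpose p q j) T) I"
    by (simp add: flip_def P_til_eq[OF assms] P_til_eq[OF ne])
qed

lemma tld_in: "i \<in> {1..n} \<Longrightarrow> tld n i \<in> {1..n}"
  by (auto simp: tld_def)

lemma tld_tld: "i \<in> {1..n} \<Longrightarrow> tld n (tld n i) = i"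
  by (auto simp: tld_def)

lemma theta_square: "theta s n i * theta s n i = 1"
  by (simp add: theta_def)

text \<open>\<open>P_til\<close> contracts two factors with the form and inserts the dual invariant
  tensor there. After \<open>P_til s n i u\<close>, contracting the inserted leg at \<open>i\<close>
  with the factor \<open>r\<close> merely carries the content of \<open>r\<close> over to
  \<open>u\<close>; what remains is the contraction of \<open>i\<close> with the old factor
  \<open>u\<close>, as if \<open>u\<close> and \<open>r\<close> had been exchanged first.\<close>

lemma P_til_P_til_flip:
  assumes "i \<noteq> r" "i \<noteq> u" "u \<noteq> r" "supported n r T"
  shows "P_til s n i r (P_til s n i u T) = P_til s n i r (flip u r T)"
proof
  fix I :: "nat \<Rightarrow> nat"
  let ?V = "\<lambda>w. T (I(i := tld n w, r := I u, u := w))"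
  \<comment> \<open>The partner of \<open>tld n v\<close> under the form is \<open>v\<close>, so of
    the outer summation only the term \<open>v = I u\<close> survives.\<close>
  have inner: "P_til s n i u T (I(i := tld n v, r := v)) =
      (if v = I u then \<Sum>w=1..n. theta s n w * theta s n (I u) * ?V w else 0)"
    if v: "v \<in> {1..n}" for v
  proof -
    show ?thesis
      using tld_in[OF v] tld_tld[OF v] assms(1-3)
      by (auto simp: P_til_eq[OF assms(2)] fun_upd_twist[OF assms(1)[symmetric]])
  qed
  have outer: "flip u r T (I(i := tld n v, r := v)) = ?V v" for v
  proof -
    have "(I(i := tld n v, r := v)) \<circ> transpose u r = I(i := tld n v, r := I u, u := v)"
      using assms(1-3) by (auto simp: fun_eq_iff transpose_def)
    then show ?thesis by (simp add: flip_def)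
  qed
  have "(\<Sum>v=1..n. theta s n v * theta s n (I r) * P_til s n i u T (I(i := tld n v, r := v)))
      = (\<Sum>v=1..n. if v = I u then theta s n v * theta s n (I r) *
          (\<Sum>w=1..n. theta s n w * theta s n (I u) * ?V w) else 0)"
    by (rule sum.cong) (auto simp: inner)
  also have "\<dots> = (\<Sum>v=1..n. theta s n v * theta s n (I r) * ?V v)"
  proof (cases "I u \<in> {1..n}")
    case True
    have "theta s n (I u) * theta s n (I r) * (theta s n w * theta s n (I u) * ?V w)
        = theta s n w * theta s n (I r) * ?V w" for w
      using theta_square[of s n "I u"] by algebra
    then have "theta s n (I u) * theta s n (I r) * (\<Sum>w=1..n. theta s n w * theta s n (I u) * ?V w)
        = (\<Sum>v=1..n. theta s n v * theta s n (I r) * ?V v)"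
      unfolding sum_distrib_left by (intro sum.cong refl)
    then show ?thesis
      using True by simp
  next
    case False
    \<comment> \<open>The index \<open>I u\<close> is never met by the summation, so the left side
      is zero. On the right it stands at position \<open>r\<close>, where the support of
      \<open>T\<close> excludes it.\<close>
    have "?V w = 0" for w
      using assms(3,4) False unfolding supported_def by (metis fun_upd_apply)
    then show ?thesis using False by simp
  qed
  finally show "P_til s n i r (P_til s n i u T) I = P_til s n i r (flip u r T) I"
    by (simp only: P_til_eq[OF assms(1)] outer)
qed

lemma P_til_P_til_skew:
  assumes "i \<noteq> r" "i \<noteq> u" "u \<noteq> r" "supported n r T" "skew u r T"
  shows "P_til s n i r (P_til s n i u T) = (\<lambda>I. - P_til s n i r T I)"
  using P_til_P_til_flip[OF assms(1-4), of s] assms(5) by (simp add: skew_def P_til_uminus)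

text \<open>For a symmetric form the image of \<open>P_til\<close> is symmetric in \<open>p\<close>
  and \<open>q\<close>. As \<open>P_til\<close> also commutes with \<open>flip p q\<close>, it takes
  \<open>T\<close> and its flip to the same tensor, whereas skewness makes these images
  opposite.\<close>

lemma P_til_Orth_skew:
  assumes "p \<noteq> q" "skew p q T"
  shows "P_til Orth n p q T = (\<lambda>I. 0)"
proof -
  have "P_til Orth n p q T = P_til Orth n p q (flip p q (flip p q T))"
    by (simp add: flip_flip)
  also have "\<dots> = flip p q (P_til Orth n p q (flip p q T))"
    using assms(1) by (subst P_til_flip) (simp_all add: P_til_sym)
  also have "\<dots> = P_til Orth n p q (flip p q T)"
  proof
    fix I :: "nat \<Rightarrow> nat"
    have upd: "(I \<circ> transpose p q)(p := u, q := v) = I(p := u, q := v)" for u v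
      by (auto simp: fun_eq_iff transpose_def)
    have "(I q \<in> {1..n} \<and> I p = tld n (I q)) = (I p \<in> {1..n} \<and> I q = tld n (I p))"
      by (auto simp: tld_def)
    then show "flip p q (P_til Orth n p q (flip p q T)) I = P_til Orth n p q (flip p q T) I"
      unfolding flip_def P_til_eq[OF assms(1)] upd by (simp add: theta_def)
  qed
  also have "\<dots> = (\<lambda>I. - P_til Orth n p q T I)"
    using assms(2) by (simp add: skew_def P_til_uminus)
  finally have "P_til Orth n p q T I = - P_til Orth n p q T I" for I
    by (rule fun_cong)
  then show ?thesis
    by (metis eq_neg_iff_add_eq_0 mult_2 mult_eq_0_iff zero_neq_numeral)
qed

lemma supported_P_til:
  assumes "p \<noteq> q" "supported n r T"
  shows "supported n r (P_til s n p q T)"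
  unfolding supported_def
proof (intro allI impI)
  fix I assume "P_til s n p q T I \<noteq> 0"
  then have I: "I p \<in> {1..n}" "I q = tld n (I p)"
    and "(\<Sum>i=1..n. theta s n i * theta s n (I q) * T (I(p := tld n i, q := i))) \<noteq> 0"
    by (auto simp: P_til_eq[OF assms(1)] split: if_splits)
  then obtain i where "T (I(p := tld n i, q := i)) \<noteq> 0"
    by (metis (no_types, lifting) mult_zero_right sum.neutral)
  then have "(I(p := tld n i, q := i)) r \<in> {1..n}"
    using assms(2) unfolding supported_def by blast
  then show "I r \<in> {1..n}"
    using I tld_in[OF I(1)] by (auto split: if_splits)
qed

lemma supported_sum:
  assumes "\<And>x. x \<in> A \<Longrightarrow> supported n r (U x)"
  shows "supported n r (\<lambda>I. \<Sum>x\<in>A. c x * U x I)"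
  using assms unfolding supported_def by (metis (no_types, lifting) mult_zero_right sum.neutral)

lemma skew_P_til:
  assumes "i \<noteq> j" "u \<notin> {i, j}" "v \<notin> {i, j}" "skew u v T"
  shows "skew u v (P_til s n i j T)"
proof -
  have "flip u v (P_til s n i j T) = P_til s n i j (flip u v T)"
    using assms by (simp add: P_til_flip)
  then show ?thesis
    using assms(4) by (simp add: skew_def P_til_uminus)
qed

section \<open>Matchings and products of operators over them\<close>

definition matching :: "(nat \<times> nat) set \<Rightarrow> bool" where
  "matching S \<longleftrightarrow> finite S \<and> (\<forall>(i, j)\<in>S. i < j) \<and>
     pairwise (\<lambda>(i, j) (k, l). {i, j} \<inter> {k, l} = {}) S"

definition matchings :: "(nat \<times> nat) set \<Rightarrow> (nat \<times> nat) set set" where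
  "matchings F = {S. S \<subseteq> F \<and> matching S}"

definition verts :: "(nat \<times> nat) set \<Rightarrow> nat set" where
  "verts S = (\<Union>(i, j)\<in>S. {i, j})"

text \<open>The common form of all operators \<open>G_op\<close> and of the partial products inside
  a block: the edge set \<open>F\<close> grows column by column while the coefficients
  \<open>c\<close> stay fixed.\<close>

definition match_sum :: "series \<Rightarrow> nat \<Rightarrow> (nat \<Rightarrow> complex) \<Rightarrow> (nat \<times> nat) set \<Rightarrow> tensor \<Rightarrow> tensor" where
  "match_sum s n c F T = (\<lambda>I. \<Sum>S\<in>matchings F. c (card S) * P_prod s n S T I)"

lemma not_verts_not_mem: "i \<notin> verts S \<Longrightarrow> (i, j) \<notin> S" "j \<notin> verts S \<Longrightarrow> (i, j) \<notin> S"
  by (auto simp: verts_def)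

lemma verts_empty: "verts {} = {}"
  by (simp add: verts_def)

lemma verts_insert: "verts (insert (i, j) S) = {i, j} \<union> verts S"
  by (simp add: verts_def)

lemma matching_empty: "matching {}"
  by (simp add: matching_def)

lemma matching_insert:
  assumes "(i, j) \<notin> S"
  shows "matching (insert (i, j) S) \<longleftrightarrow> matching S \<and> i < j \<and> {i, j} \<inter> verts S = {}"
proof -
  let ?r = "\<lambda>(i, j) (k, l). {i, j} \<inter> {k, l} = ({} :: nat set)"
  have "?r (i, j) y \<and> ?r y (i, j) \<longleftrightarrow> {i, j} \<inter> {fst y, snd y} = {}" for y
    by (auto simp: split_beta)
  then have "pairwise ?r (insert (i, j) S) \<longleftrightarrow>
      (\<forall>y. y \<in> S \<and> y \<noteq> (i, j) \<longrightarrow> {i, j} \<inter> {fst y, snd y} = {}) \<and> pairwise ?r S"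
    unfolding pairwise_insert by (simp only:)
  moreover have "(\<forall>y. y \<in> S \<and> y \<noteq> (i, j) \<longrightarrow> {i, j} \<inter> {fst y, snd y} = {})
      \<longleftrightarrow> (\<forall>y\<in>S. {i, j} \<inter> {fst y, snd y} = {})"
    using assms by metis
  moreover have "\<dots> \<longleftrightarrow> {i, j} \<inter> verts S = {}"
    unfolding verts_def split_beta by blast
  moreover have "(\<forall>(k, l)\<in>insert (i, j) S. k < l) \<longleftrightarrow> i < j \<and> (\<forall>(k, l)\<in>S. k < l)"
    by simp
  ultimately show ?thesis
    unfolding matching_def finite_insert by argo
qed

lemma matching_induct [consumes 1, case_names empty insert]:
  assumes "matching S" and "P {}"
    and "\<And>i j S. \<lbrakk>matching S; i < j; {i, j} \<inter> verts S = {}; P S\<rbrakk> \<Longrightarrow> P (insert (i, j) S)"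
  shows "P S"
proof -
  have "finite S" using assms(1) by (simp add: matching_def)
  then show ?thesis
    using assms(1)
  proof (induction S rule: finite_induct)
    case (insert e S)
    obtain i j where e: "e = (i, j)" by (cases e)
    then show ?case
      using insert matching_insert[of i j S] assms(3)[of S i j] by simp
  qed (rule assms(2))
qed

lemma P_prod_insert_verts:
  assumes "matching S" "i < j" "{i, j} \<inter> verts S = {}"
  shows "P_prod s n (insert (i, j) S) T = P_til s n i j (P_prod s n S T)"
proof (rule P_prod_insert)
  show nin: "(i, j) \<notin> S" using assms(3) by (auto dest: not_verts_not_mem)
  then have "matching (insert (i, j) S)"
    using assms by (simp add: matching_insert)
  then show "\<forall>(k, l)\<in>insert (i, j) S. k \<noteq> l"
    and "pairwise (\<lambda>(i, j) (k, l). {i, j} \<inter> {k, l} = {}) (insert (i, j) S)"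
    unfolding matching_def by auto
  show "finite S" using assms(1) by (simp add: matching_def)
qed

lemma P_prod_uminus: "matching S \<Longrightarrow> P_prod s n S (\<lambda>I. - T I) = (\<lambda>I. - P_prod s n S T I)"
  by (induction S rule: matching_induct) (simp_all add: P_prod_empty P_prod_insert_verts P_til_uminus)

lemma supported_P_prod:
  assumes "matching S" "supported n r T"
  shows "supported n r (P_prod s n S T)"
  using assms(1)
proof (induction S rule: matching_induct)
  case empty
  then show ?case using assms(2) by (simp add: P_prod_empty)
next
  case (insert i j S)
  then show ?case by (simp add: P_prod_insert_verts supported_P_til)
qed

lemma skew_P_prod:
  assumes "matching S" "skew u v T" "u \<notin> verts S" "v \<notin> verts S"
  shows "skew u v (P_prod s n S T)"
  using assms(1,3,4)
proof (induction S rule: matching_induct)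
  case empty
  then show ?case using assms(2) by (simp add: P_prod_empty)
next
  case (insert i j S)
  then show ?case by (auto intro!: skew_P_til simp: P_prod_insert_verts verts_insert)
qed

section \<open>Permuting positions in a sum over matchings\<close>

text \<open>Edges are stored with the smaller end first, and a permutation of positions may reverse
  them; \<open>min\<close> and \<open>max\<close> restore the order, at no cost for the operators
  because of \<open>P_til_sym\<close>.\<close>

definition relabel :: "(nat \<Rightarrow> nat) \<Rightarrow> (nat \<times> nat) set \<Rightarrow> (nat \<times> nat) set" where
  "relabel f S = (\<lambda>(i, j). (min (f i) (f j), max (f i) (f j))) ` S"

lemma relabel_empty: "relabel f {} = {}"
  by (simp add: relabel_def)

lemma relabel_insert: "relabel f (insert (i, j) S) = insert (min (f i) (f j), max (f i) (f j)) (relabel f S)"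
  by (simp add: relabel_def)

lemma relabel_mono: "S \<subseteq> F \<Longrightarrow> relabel f S \<subseteq> relabel f F"
  unfolding relabel_def by (rule image_mono)

lemma min_max_set: "{min i j, max i j} = {i, j :: nat}"
  by (auto simp: min_def max_def)

lemma verts_relabel: "verts (relabel f S) = f ` verts S"
proof -
  have "verts (relabel f S) = (\<Union>(i, j)\<in>S. {min (f i) (f j), max (f i) (f j)})"
    by (simp add: verts_def relabel_def split_beta)
  then show ?thesis
    by (auto simp: min_max_set verts_def)
qed

text \<open>This rests on the order \<open>i < j\<close> inside a matching: an edge stored the other
  way would come back reversed.\<close>

lemma relabel_relabel:
  assumes "matching S"
  shows "relabel (transpose p q) (relabel (transpose p q) S) = S"
  using assms
proof (induction S rule: matching_induct)
  case (insert i j S)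
  then show ?case
    by (cases "transpose p q i \<le> transpose p q j") (simp_all add: relabel_insert min_def max_def)
qed (simp add: relabel_empty)

lemma disjnt_relabel:
  assumes "{i, j} \<inter> verts S = {}"
  shows "{min (transpose p q i) (transpose p q j), max (transpose p q i) (transpose p q j)}
    \<inter> verts (relabel (transpose p q) S) = {}"
  unfolding min_max_set verts_relabel
  using assms image_Int[OF inj_on_transpose[of p q UNIV], of "{i, j}" "verts S"] by simp

lemma relabel_ordered:
  fixes i j :: nat
  assumes "i < j"
  shows "min (transpose p q i) (transpose p q j) < max (transpose p q i) (transpose p q j)"
proof -
  have "transpose p q i \<noteq> transpose p q j"
    using assms by (intro transpose_neq) simp
  then show ?thesis by (auto simp: min_def max_def)
qed

lemma matching_relabel:
  assumes "matching S"
  shows "matching (relabel (transpose p q) S) \<and> card (relabel (transpose p q) S) = card S"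
  using assms
proof (induction S rule: matching_induct)
  case empty
  then show ?case by (simp add: relabel_empty matching_empty)
next
  case (insert i j S)
  let ?e = "(min (transpose p q i) (transpose p q j), max (transpose p q i) (transpose p q j))"
  note dj = disjnt_relabel[OF insert.hyps(3), of p q]
  have nin: "(i, j) \<notin> S" "?e \<notin> relabel (transpose p q) S"
    using insert.hyps(3) dj by (auto dest: not_verts_not_mem)
  then have "matching (relabel (transpose p q) (insert (i, j) S))"
    using insert.IH relabel_ordered[OF insert.hyps(2), of p q] dj
    unfolding relabel_insert matching_insert[OF nin(2)] by blast
  moreover have "finite S" "finite (relabel (transpose p q) S)"
    using insert.hyps(1) insert.IH by (auto simp: matching_def)
  ultimately show ?case
    using insert.IH nin by (simp add: relabel_insert)
qed

text \<open>The flip passes one edge at a time by \<open>P_til_flip\<close>; the parity of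
  \<open>n\<close> enters through \<open>P_til_sym\<close>, which absorbs the reordering of edges in
  \<open>relabel\<close>.\<close>

lemma P_prod_flip:
  assumes "matching S" "s = Symp \<longrightarrow> even n"
  shows "P_prod s n S (flip p q T) = flip p q (P_prod s n (relabel (transpose p q) S) T)"
  using assms(1)
proof (induction S rule: matching_induct)
  case empty
  then show ?case by (simp add: relabel_empty P_prod_empty)
next
  case (insert i j S)
  let ?t = "transpose p q" let ?S = "relabel (transpose p q) S"
  have ne: "?t i \<noteq> ?t j" using insert.hyps(2) by (intro transpose_neq) simp
  have "P_prod s n (insert (i, j) S) (flip p q T) = P_til s n i j (flip p q (P_prod s n ?S T))"
    using insert by (simp add: P_prod_insert_verts)
  also have "\<dots> = flip p q (P_til s n (?t i) (?t j) (P_prod s n ?S T))"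
    using insert.hyps(2) by (simp add: P_til_flip)
  also have "P_til s n (?t i) (?t j) (P_prod s n ?S T)
      = P_til s n (min (?t i) (?t j)) (max (?t i) (?t j)) (P_prod s n ?S T)"
    using P_til_sym[OF ne assms(2)] by (simp add: min_def max_def)
  also have "\<dots> = P_prod s n (relabel ?t (insert (i, j) S)) T"
    unfolding relabel_insert
    by (rule P_prod_insert_verts[OF conjunct1[OF matching_relabel[OF insert.hyps(1)]]
        relabel_ordered[OF insert.hyps(2)] disjnt_relabel[OF insert.hyps(3)], symmetric])
  finally show ?case .
qed

text \<open>Moving the flip through a product relabels its matching. This is an involution of
  \<open>matchings F\<close> that keeps the cardinality, hence the coefficient, so only the sign
  coming from \<open>T\<close> is left.\<close>

lemma skew_match_sum:
  assumes "s = Symp \<longrightarrow> even n" "relabel (transpose p q) F \<subseteq> F" "skew p q T"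
  shows "skew p q (match_sum s n c F T)"
proof -
  let ?r = "relabel (transpose p q)"
  have M: "matching S" if "S \<in> matchings F" for S
    using that by (simp add: matchings_def)
  have flip_P: "flip p q (P_prod s n S T) I = - P_prod s n (?r S) T I" if S: "S \<in> matchings F" for S I
  proof -
    have "P_prod s n (?r S) (flip p q T) = flip p q (P_prod s n (?r (?r S)) T)"
      using matching_relabel[OF M[OF S]] assms(1) by (intro P_prod_flip) auto
    also have "?r (?r S) = S" using M[OF S] by (rule relabel_relabel)
    finally have "flip p q (P_prod s n S T) = (\<lambda>I. - P_prod s n (?r S) T I)"
      using assms(3) matching_relabel[OF M[OF S], of p q] by (simp add: skew_def P_prod_uminus)
    then show ?thesis by simp
  qed
  have rM: "?r S \<in> matchings F" if S: "S \<in> matchings F" for S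
    using matching_relabel[OF M[OF S], of p q] relabel_mono[of S F "transpose p q"] assms(2) S
    by (auto simp: matchings_def)
  have "flip p q (match_sum s n c F T) I = - match_sum s n c F T I" for I
  proof -
    have "flip p q (match_sum s n c F T) I = (\<Sum>S\<in>matchings F. c (card S) * flip p q (P_prod s n S T) I)"
      by (simp add: match_sum_def flip_def)
    also have "\<dots> = (\<Sum>S\<in>matchings F. - (c (card S) * P_prod s n (?r S) T I))"
      by (intro sum.cong) (auto simp: flip_P)
    also have "\<dots> = (\<Sum>S\<in>matchings F. - (c (card S) * P_prod s n S T I))"
      by (rule sum.reindex_bij_witness[of _ ?r ?r])
        (simp_all add: rM M matching_relabel relabel_relabel)
    finally show ?thesis by (simp add: match_sum_def sum_negf)
  qed
  then show ?thesis by (simp add: skew_def fun_eq_iff)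
qed

lemma supported_match_sum:
  assumes "supported n r T"
  shows "supported n r (match_sum s n c F T)"
  unfolding match_sum_def using assms
  by (intro supported_sum supported_P_prod) (auto simp: matchings_def)

lemma finite_matchings: "finite F \<Longrightarrow> finite (matchings F)"
  unfolding matchings_def by (rule finite_subset[of _ "Pow F"]) auto

lemma verts_mono: "S \<subseteq> F \<Longrightarrow> verts S \<subseteq> verts F"
  unfolding verts_def by blast

section \<open>Adding a column of edges to a sum over matchings\<close>

text \<open>If the matching \<open>S\<close> avoids \<open>i\<close>, these are the edges at
  \<open>i\<close> that enlarge it to a matching again; every matching in \<open>F\<close> that
  covers \<open>i\<close> arises in this way exactly once.\<close>

definition free_edges :: "(nat \<times> nat) set \<Rightarrow> nat \<Rightarrow> (nat \<times> nat) set \<Rightarrow> (nat \<times> nat) set" where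
  "free_edges F i S = {e \<in> F. i \<in> {fst e, snd e} \<and> {fst e, snd e} \<inter> verts S = {}}"

text \<open>The matchings covering \<open>i\<close> are grouped by what is left after removing the
  edge at \<open>i\<close>. By \<open>P_til_P_til_skew\<close> each becomes minus the term of its
  remainder. A matching avoiding \<open>i\<close> thus collects its own coefficient and, for every
  free edge, a negative copy of the next one; \<open>count\<close> says that the total is
  \<open>d\<close> times the next coefficient.\<close>

lemma P_til_match_sum:
  assumes "finite F" "\<And>k l. (k, l) \<in> F \<Longrightarrow> k < l" "r \<notin> verts F" "i < r"
    and "supported n r T" "s = Symp \<longrightarrow> even n"
    and skew: "\<And>u. (i, u) \<in> F \<or> (u, i) \<in> F \<Longrightarrow> skew u r T"
    and count: "\<And>S. S \<in> matchings F \<Longrightarrow> i \<notin> verts S \<Longrightarrow>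
      c (card S) - of_nat (card (free_edges F i S)) * c (Suc (card S)) = d * c (Suc (card S))"
  shows "P_til s n i r (match_sum s n c F T) I
    = d * (\<Sum>S | S \<in> matchings F \<and> i \<notin> verts S. c (Suc (card S)) * P_prod s n (insert (i, r) S) T I)"
proof -
  let ?M0 = "{S \<in> matchings F. i \<notin> verts S}" and ?M1 = "{S \<in> matchings F. i \<in> verts S}"
  let ?h = "\<lambda>S. P_til s n i r (P_prod s n S T) I"
  have fin: "finite (matchings F)" using assms(1) by (rule finite_matchings)
  have M: "matching S" "S \<subseteq> F" "finite S" "r \<notin> verts S" if "S \<in> matchings F" for S
    using that assms(3) verts_mono[of S F] by (auto simp: matchings_def matching_def)
  have freeE: "\<exists>k l. e = (k, l) \<and> (k, l) \<in> F \<and> k < l \<and> (k = i \<or> l = i) \<and> {k, l} \<inter> verts S = {} \<and> (k, l) \<notin> S"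
    if "e \<in> free_edges F i S" for e S
    using that assms(2) by (cases e) (auto simp: free_edges_def dest: not_verts_not_mem)
  have bij: "bij_betw (\<lambda>(S, e). insert e S) (Sigma ?M0 (free_edges F i)) ?M1"
    unfolding bij_betw_def
  proof
    show "inj_on (\<lambda>(S, e). insert e S) (Sigma ?M0 (free_edges F i))"
    proof (rule inj_onI)
      fix x x' assume x: "x \<in> Sigma ?M0 (free_edges F i)" "x' \<in> Sigma ?M0 (free_edges F i)"
        and eq: "(case x of (S, e) \<Rightarrow> insert e S) = (case x' of (S, e) \<Rightarrow> insert e S)"
      obtain S e S' e' where xs: "x = (S, e)" "x' = (S', e')" by (cases x, cases x')
      \<comment> \<open>Both \<open>S\<close> and \<open>S'\<close> avoid \<open>i\<close> while
        \<open>e\<close> and \<open>e'\<close> contain it, so the added edge can be recognised in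
        the union.\<close>
      have "e \<notin> S" "e \<notin> S'" "e' \<notin> S" "e' \<notin> S'"
        using x freeE[of e S] freeE[of e' S'] by (auto simp: xs verts_def)
      then show "x = x'" using eq by (auto simp: xs)
    qed
    show "(\<lambda>(S, e). insert e S) ` Sigma ?M0 (free_edges F i) = ?M1"
    proof (intro set_eqI iffI)
      fix S assume "S \<in> (\<lambda>(S, e). insert e S) ` Sigma ?M0 (free_edges F i)"
      then obtain S0 e where S: "S = insert e S0" "S0 \<in> ?M0" "e \<in> free_edges F i S0" by auto
      from freeE[OF S(3)] obtain k l where e: "e = (k, l)" "(k, l) \<in> F" "k < l" "k = i \<or> l = i"
        "{k, l} \<inter> verts S0 = {}" "(k, l) \<notin> S0" by blast
      have S0: "S0 \<in> matchings F" using S(2) by simp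
      have "matching S"
        unfolding S(1) e(1) matching_insert[OF e(6)] using M(1)[OF S0] e(3,5) by blast
      moreover have "S \<subseteq> F" using M(2)[OF S0] e(2) by (simp add: S(1) e(1))
      moreover have "i \<in> verts S" using e(4) by (auto simp: S(1) e(1) verts_insert)
      ultimately show "S \<in> ?M1" by (simp add: matchings_def)
    next
      fix S assume S: "S \<in> ?M1"
      then obtain k l where e: "(k, l) \<in> S" "k = i \<or> l = i" by (auto simp: verts_def)
      let ?S = "S - {(k, l)}"
      have "matching (insert (k, l) ?S)" using S e M(1)[of S] by (simp add: insert_absorb)
      then have "matching ?S" "{k, l} \<inter> verts ?S = {}"
        by (subst (asm) matching_insert; simp)+
      then have "?S \<in> ?M0" "(k, l) \<in> free_edges F i ?S"
        using S e M(2)[of S] by (auto simp: matchings_def free_edges_def)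
      moreover have "S = insert (k, l) ?S" using e by auto
      ultimately show "S \<in> (\<lambda>(S, e). insert e S) ` Sigma ?M0 (free_edges F i)"
        by (intro image_eqI[where x = "(?S, (k, l))"]) auto
    qed
  qed
  \<comment> \<open>The edge may be stored as \<open>(i, u)\<close> or \<open>(u, i)\<close>. Since
    \<open>S\<close> touches neither \<open>u\<close> nor \<open>r\<close>, the product over
    \<open>S\<close> is still skew in them.\<close>
  have absorb: "c (card (insert e S)) * ?h (insert e S) = - (c (Suc (card S)) * ?h S)"
    if S: "S \<in> ?M0" and e: "e \<in> free_edges F i S" for S e
  proof -
    obtain u where u: "e = (i, u) \<or> e = (u, i)" "i \<noteq> u" "e \<notin> S" "u \<notin> verts S" "skew u r T" "u \<noteq> r"
      using freeE[OF e] skew assms(3) by (fastforce simp: verts_def)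
    have MS: "matching S" "r \<notin> verts S" "finite S" using S M by auto
    have "P_prod s n (insert e S) T = P_til s n i u (P_prod s n S T)"
      using freeE[OF e] u(1,2) MS P_til_sym[OF u(2) assms(6)] by (auto simp: P_prod_insert_verts)
    then have "P_til s n i r (P_prod s n (insert e S) T) = (\<lambda>I. - P_til s n i r (P_prod s n S T) I)"
      using u MS assms(4,5) by (simp add: P_til_P_til_skew supported_P_prod skew_P_prod)
    then show ?thesis using u(3) MS by simp
  qed
  have "P_til s n i r (match_sum s n c F T) I = (\<Sum>S\<in>matchings F. c (card S) * ?h S)"
    by (simp add: match_sum_def P_til_sum)
  also have "\<dots> = (\<Sum>S\<in>?M0 \<union> ?M1. c (card S) * ?h S)"
    by (rule sum.cong) auto
  also have "\<dots> = (\<Sum>S\<in>?M0. c (card S) * ?h S) + (\<Sum>S\<in>?M1. c (card S) * ?h S)"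
    using fin by (intro sum.union_disjoint) auto
  also have "(\<Sum>S\<in>?M1. c (card S) * ?h S)
      = (\<Sum>(S, e)\<in>Sigma ?M0 (free_edges F i). c (card (insert e S)) * ?h (insert e S))"
    by (subst sum.reindex_bij_betw[OF bij, symmetric]) (simp add: split_beta)
  also have "\<dots> = (\<Sum>S\<in>?M0. \<Sum>e\<in>free_edges F i S. c (card (insert e S)) * ?h (insert e S))"
    using fin assms(1) by (intro sum.Sigma[symmetric]) (auto simp: free_edges_def)
  also have "\<dots> = (\<Sum>S\<in>?M0. \<Sum>e\<in>free_edges F i S. - (c (Suc (card S)) * ?h S))"
    by (intro sum.cong refl absorb)
  also have "(\<Sum>S\<in>?M0. c (card S) * ?h S) + \<dots>
      = (\<Sum>S\<in>?M0. (c (card S) - of_nat (card (free_edges F i S)) * c (Suc (card S))) * ?h S)"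
    by (simp add: sum.distrib[symmetric] algebra_simps)
  also have "\<dots> = (\<Sum>S\<in>?M0. d * (c (Suc (card S)) * P_prod s n (insert (i, r) S) T I))"
    using M assms(4) by (intro sum.cong) (auto simp: count P_prod_insert_verts)
  finally show ?thesis by (simp add: sum_distrib_left)
qed

text \<open>All new edges meet in \<open>r\<close>, so a matching contains at most one of them. The
  matchings with an edge \<open>(i, r)\<close> are those of \<open>F\<close> avoiding
  \<open>i\<close>, enlarged by this edge, and their sum is computed by
  \<open>P_til_match_sum\<close>.\<close>

lemma match_sum_add_column:
  assumes "finite F" "\<And>k l. (k, l) \<in> F \<Longrightarrow> k < l" "r \<notin> verts F" "finite J" "\<And>i. i \<in> J \<Longrightarrow> i < r"
    and "supported n r T" "s = Symp \<longrightarrow> even n" "d \<noteq> 0"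
    and skew: "\<And>i u. i \<in> J \<Longrightarrow> (i, u) \<in> F \<or> (u, i) \<in> F \<Longrightarrow> skew u r T"
    and count: "\<And>i S. i \<in> J \<Longrightarrow> S \<in> matchings F \<Longrightarrow> i \<notin> verts S \<Longrightarrow>
      c (card S) - of_nat (card (free_edges F i S)) * c (Suc (card S)) = d * c (Suc (card S))"
  shows "match_sum s n c (F \<union> (\<lambda>i. (i, r)) ` J) T
    = (\<lambda>I. match_sum s n c F T I + inverse d * (\<Sum>i\<in>J. P_til s n i r (match_sum s n c F T) I))"
proof
  fix I
  let ?F = "F \<union> (\<lambda>i. (i, r)) ` J"
  let ?M0 = "\<lambda>i. {S \<in> matchings F. i \<notin> verts S}"
  have fin: "finite (matchings F)" "finite (matchings ?F)"
    using assms(1,4) by (auto intro: finite_matchings)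
  have M: "matching S" "S \<subseteq> F" "finite S" "r \<notin> verts S" if "S \<in> matchings F" for S
    using that assms(3) verts_mono[of S F] by (auto simp: matchings_def matching_def)
  have nin: "(i, r) \<notin> S" if "S \<in> matchings F" for i S
    using M(4)[OF that] by (auto dest: not_verts_not_mem)
  have bij: "bij_betw (\<lambda>(i, S). insert (i, r) S) (Sigma J ?M0) (matchings ?F - matchings F)"
    unfolding bij_betw_def
  proof
    show "inj_on (\<lambda>(i, S). insert (i, r) S) (Sigma J ?M0)"
    proof (rule inj_onI, clarify)
      fix i S i' S' assume S: "S \<in> matchings F" "S' \<in> matchings F" and eq: "insert (i, r) S = insert (i', r) S'"
      have "i' = i" using eq nin[OF S(1), of i'] by blast
      moreover have "S = S'"
        using insert_ident[OF nin[OF S(1), of i] nin[OF S(2), of i]] eq unfolding calculation by (rule iffD1)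
      ultimately show "i = i' \<and> S = S'" by (rule conjI[OF sym])
    qed
    show "(\<lambda>(i, S). insert (i, r) S) ` Sigma J ?M0 = matchings ?F - matchings F"
    proof (intro set_eqI iffI)
      fix S assume "S \<in> (\<lambda>(i, S). insert (i, r) S) ` Sigma J ?M0"
      then obtain i S0 where S: "S = insert (i, r) S0" "i \<in> J" "S0 \<in> matchings F" "i \<notin> verts S0" by auto
      have "matching S"
        using S(2,4) M(1,4)[OF S(3)] assms(5) by (simp add: S(1) matching_insert[OF nin[OF S(3)]])
      moreover have "S \<subseteq> ?F" using M(2)[OF S(3)] S(1,2) by blast
      moreover have "(i, r) \<notin> F" using assms(3) by (auto dest: not_verts_not_mem)
      ultimately show "S \<in> matchings ?F - matchings F"
        using S(1) by (simp add: matchings_def)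
    next
      fix S assume S: "S \<in> matchings ?F - matchings F"
      then obtain i where i: "i \<in> J" "(i, r) \<in> S" by (auto simp: matchings_def)
      let ?S = "S - {(i, r)}"
      have "matching (insert (i, r) ?S)" using S i by (simp add: insert_absorb matchings_def)
      then have S': "matching ?S" "{i, r} \<inter> verts ?S = {}"
        by (subst (asm) matching_insert; simp)+
      \<comment> \<open>Any further edge of the column would contain \<open>r\<close>, which is
        already covered.\<close>
      have "?S \<subseteq> F"
      proof
        fix e assume e: "e \<in> ?S"
        moreover have "e \<noteq> (i', r)" for i'
          using S'(2) e by (auto simp: verts_def)
        ultimately show "e \<in> F" using S by (auto simp: matchings_def)
      qed
      then show "S \<in> (\<lambda>(i, S). insert (i, r) S) ` Sigma J ?M0"
        using S' i by (intro image_eqI[where x = "(i, ?S)"]) (auto simp: matchings_def)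
    qed
  qed
  have "match_sum s n c ?F T I = match_sum s n c F T I
      + (\<Sum>S\<in>matchings ?F - matchings F. c (card S) * P_prod s n S T I)"
    unfolding match_sum_def using fin by (subst sum.subset_diff[of "matchings F"]) (auto simp: matchings_def)
  also have "(\<Sum>S\<in>matchings ?F - matchings F. c (card S) * P_prod s n S T I)
      = (\<Sum>(i, S)\<in>Sigma J ?M0. c (card (insert (i, r) S)) * P_prod s n (insert (i, r) S) T I)"
    by (subst sum.reindex_bij_betw[OF bij, symmetric]) (simp add: split_beta)
  also have "\<dots> = (\<Sum>i\<in>J. \<Sum>S\<in>?M0 i. c (card (insert (i, r) S)) * P_prod s n (insert (i, r) S) T I)"
    using fin assms(4) by (intro sum.Sigma[symmetric]) auto
  also have "\<dots> = (\<Sum>i\<in>J. \<Sum>S\<in>?M0 i. c (Suc (card S)) * P_prod s n (insert (i, r) S) T I)"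
    using M nin by (intro sum.cong refl) simp
  also have "\<dots> = (\<Sum>i\<in>J. inverse d * P_til s n i r (match_sum s n c F T) I)"
  proof (rule sum.cong[OF refl])
    fix i assume i: "i \<in> J"
    have "P_til s n i r (match_sum s n c F T) I
      = d * (\<Sum>S\<in>?M0 i. c (Suc (card S)) * P_prod s n (insert (i, r) S) T I)"
      using assms(1-3,5-7) skew count i by (intro P_til_match_sum) auto
    then show "(\<Sum>S\<in>?M0 i. c (Suc (card S)) * P_prod s n (insert (i, r) S) T I)
        = inverse d * P_til s n i r (match_sum s n c F T) I"
      using assms(8) by simp
  qed
  finally show "match_sum s n c ?F T I
      = match_sum s n c F T I + inverse d * (\<Sum>i\<in>J. P_til s n i r (match_sum s n c F T) I)"
    by (simp add: sum_distrib_left)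
qed

section \<open>The product of the factors in one column\<close>

text \<open>After \<open>k\<close> factors the product is \<open>1\<close> plus
  \<open>inverse d\<close> times the sum of \<open>k\<close> operators. The next operator absorbs
  each of these with a minus sign and so gets the coefficient \<open>1 - k / d\<close>; the
  parameter \<open>k - d\<close> is the one that turns this into \<open>inverse d\<close>
  again.\<close>

lemma fold_R_til_column:
  assumes "distinct ps" "r \<notin> set ps" "s = Symp \<longrightarrow> even n"
    and "\<And>p q. p \<in> set ps \<Longrightarrow> q \<in> set ps \<Longrightarrow> p \<noteq> q \<Longrightarrow> skew p q U"
    and "\<And>p. p \<in> set ps \<Longrightarrow> supported n p U"
    and "\<And>k. k < length ps \<Longrightarrow> x (ps ! k) = of_nat k - d \<and> of_nat k \<noteq> d"
  shows "fold (\<lambda>p. R_til s n (x p) p r) ps U = (\<lambda>I. U I + inverse d * (\<Sum>p\<in>set ps. P_til s n p r U I))"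
  using assms
proof (induction ps rule: rev_induct)
  case (snoc p ps)
  let ?k = "length ps"
  let ?V = "\<lambda>I. U I + inverse d * (\<Sum>q\<in>set ps. P_til s n q r U I)"
  have IH: "fold (\<lambda>p. R_til s n (x p) p r) ps U = ?V"
  proof (rule snoc.IH)
    show "x (ps ! k) = of_nat k - d \<and> of_nat k \<noteq> d" if "k < length ps" for k
      using snoc.prems(6)[of k] that by (simp add: nth_append)
  qed (use snoc.prems in auto)
  have x: "x p = of_nat ?k - d" "of_nat ?k \<noteq> d" "d \<noteq> 0"
    using snoc.prems(6)[of ?k] snoc.prems(6)[of 0] by auto
  have pr: "p \<noteq> r" "p \<notin> set ps" using snoc.prems(1,2) by auto
  have absorb: "P_til s n p r (P_til s n q r U) I = - P_til s n p r U I" if q: "q \<in> set ps" for q I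
  proof -
    have qr: "q \<noteq> r" using snoc.prems(2) q by auto
    \<comment> \<open>Here \<open>r\<close> is the factor common to both operators, and skewness is
      used in \<open>p\<close> and \<open>q\<close>.\<close>
    have "P_til s n r p (P_til s n r q U) = (\<lambda>I. - P_til s n r p U I)"
      using snoc.prems(4,5) q pr qr by (intro P_til_P_til_skew) auto
    then show ?thesis
      using P_til_sym[OF pr(1) snoc.prems(3)] P_til_sym[OF qr snoc.prems(3)] by simp
  qed
  have "P_til s n p r ?V = (\<lambda>I. P_til s n p r U I
      + inverse d * (\<Sum>q\<in>set ps. P_til s n p r (P_til s n q r U) I))"
    using P_til_linear[of s n p r U "inverse d" "\<lambda>I. \<Sum>q\<in>set ps. P_til s n q r U I"]
      P_til_sum[of s n p r "\<lambda>q. 1" "\<lambda>q. P_til s n q r U" "set ps"] by simp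
  also have "\<dots> = (\<lambda>I. (1 - inverse d * of_nat ?k) * P_til s n p r U I)"
    using snoc.prems(1) by (simp add: absorb distinct_card algebra_simps)
  finally have "P_til s n p r ?V I = (1 - inverse d * of_nat ?k) * P_til s n p r U I" for I
    by simp
  moreover have "- (inverse (x p) * (1 - inverse d * of_nat ?k)) = inverse d"
  proof -
    have "of_nat ?k - d \<noteq> 0" using x(2) by simp
    then show ?thesis unfolding x(1) using x(3) by (simp add: field_simps)
  qed
  ultimately have "- (inverse (x p) * P_til s n p r ?V I) = inverse d * P_til s n p r U I" for I
    by (metis (no_types, lifting) minus_mult_left mult.assoc)
  then have "?V I - inverse (x p) * P_til s n p r ?V I = ?V I + inverse d * P_til s n p r U I" for I
    by (metis (no_types, lifting) diff_conv_add_uminus)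
  then have "R_til s n (x p) p r ?V = (\<lambda>I. ?V I + inverse d * P_til s n p r U I)"
    unfolding R_til_def by (intro ext)
  moreover have "fold (\<lambda>p. R_til s n (x p) p r) (ps @ [p]) U = R_til s n (x p) p r ?V"
    unfolding IH[symmetric] by simp
  ultimately show ?case
    using pr(2) by (simp add: algebra_simps)
qed simp

section \<open>Edges between two sets of positions and the count of free edges\<close>

definition edges :: "nat set \<Rightarrow> nat set \<Rightarrow> (nat \<times> nat) set" where
  "edges A B = {(p, q) \<in> A \<times> B. p < q}"

lemma finite_edges: "finite A \<Longrightarrow> finite B \<Longrightarrow> finite (edges A B)"
  unfolding edges_def by (rule finite_subset[of _ "A \<times> B"]) auto

lemma relabel_edges:
  assumes "A = B \<or> (\<forall>p\<in>A. \<forall>q\<in>B. p < q)" "u \<in> A \<longleftrightarrow> v \<in> A" "u \<in> B \<longleftrightarrow> v \<in> B"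
  shows "relabel (transpose u v) (edges A B) \<subseteq> edges A B"
proof -
  have im: "transpose u v p \<in> A \<longleftrightarrow> p \<in> A" "transpose u v p \<in> B \<longleftrightarrow> p \<in> B" for p
    using assms(2,3) by (auto simp: transpose_def)
  have "(min (transpose u v p) (transpose u v q), max (transpose u v p) (transpose u v q)) \<in> edges A B"
    if pq: "p \<in> A" "q \<in> B" "p < q" for p q
    using assms(1)
  proof
    assume "A = B"
    then show ?thesis
      using pq im relabel_ordered[OF pq(3), of u v] by (auto simp: edges_def min_def max_def)
  next
    assume "\<forall>p\<in>A. \<forall>q\<in>B. p < q"
    then have "transpose u v p < transpose u v q" using pq im by blast
    then show ?thesis using pq im by (simp add: edges_def min_def max_def)
  qed
  then show ?thesis by (auto simp: relabel_def edges_def)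
qed

lemma card_verts:
  assumes "matching S"
  shows "card (verts S) = 2 * card S"
  using assms
proof (induction S rule: matching_induct)
  case empty
  then show ?case by (simp add: verts_empty)
next
  case (insert i j S)
  have "finite S" "finite (verts S)" using insert.hyps(1) by (auto simp: matching_def verts_def)
  moreover have "(i, j) \<notin> S" using insert.hyps(3) by (auto dest: not_verts_not_mem)
  ultimately show ?case using insert by (simp add: verts_insert)
qed

lemma card_verts_Int:
  assumes "matching S" "S \<subseteq> A \<times> B" "A \<inter> B = {}"
  shows "card (B \<inter> verts S) = card S"
  using assms
proof (induction S rule: matching_induct)
  case empty
  then show ?case by (simp add: verts_empty)
next
  case (insert i j S)
  have "finite S" "finite (B \<inter> verts S)" using insert.hyps(1) by (auto simp: matching_def verts_def)
  moreover have "(i, j) \<notin> S" using insert.hyps(3) by (auto dest: not_verts_not_mem)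
  moreover have "B \<inter> verts (insert (i, j) S) = insert j (B \<inter> verts S)"
    using insert.prems by (auto simp: verts_insert)
  ultimately show ?case using insert by simp
qed

lemma verts_edges: "verts (edges A B) \<subseteq> A \<union> B"
  by (auto simp: verts_def edges_def)

text \<open>Every element of \<open>B\<close> is a neighbour of \<open>i\<close>, and each edge of
  \<open>S\<close> occupies exactly one of them.\<close>

lemma card_free_edges_cross:
  assumes "\<forall>p\<in>A. \<forall>q\<in>B. p < q" "finite B" "S \<in> matchings (edges A B)" "i \<in> A" "i \<notin> verts S"
  shows "card (free_edges (edges A B) i S) + card S = card B"
proof -
  have "free_edges (edges A B) i S = (\<lambda>u. (i, u)) ` (B - verts S)"
    using assms(1,4,5) by (force simp: free_edges_def edges_def)
  then have "card (free_edges (edges A B) i S) = card (B - verts S)"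
    by (simp add: card_image inj_on_def)
  moreover have "card (B \<inter> verts S) = card S"
    using assms(1,3) by (intro card_verts_Int[of _ A]) (auto simp: matchings_def edges_def)
  ultimately show ?thesis
    using card_Int_Diff[OF assms(2), of "verts S"] by simp
qed

text \<open>Each edge of \<open>S\<close> occupies two elements of \<open>A\<close>; the extra
  \<open>1\<close> is \<open>i\<close> itself, which is not its own neighbour.\<close>

lemma card_free_edges_self:
  assumes "finite A" "S \<in> matchings (edges A A)" "i \<in> A" "i \<notin> verts S"
  shows "card (free_edges (edges A A) i S) + 2 * card S + 1 = card A"
proof -
  let ?f = "\<lambda>u. (min i u, max i u)"
  have "free_edges (edges A A) i S = ?f ` (A - insert i (verts S))"
  proof (intro set_eqI iffI)
    fix e assume e: "e \<in> free_edges (edges A A) i S"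
    then obtain k l where kl: "e = (k, l)" "k \<in> A" "l \<in> A" "k < l" "k = i \<or> l = i" "{k, l} \<inter> verts S = {}"
      by (cases e) (auto simp: free_edges_def edges_def)
    then show "e \<in> ?f ` (A - insert i (verts S))"
      by (intro image_eqI[where x = "if k = i then l else k"]) (auto simp: min_def max_def)
  next
    fix e assume "e \<in> ?f ` (A - insert i (verts S))"
    then obtain u where "e = ?f u" "u \<in> A" "u \<noteq> i" "u \<notin> verts S" by auto
    then show "e \<in> free_edges (edges A A) i S"
      using assms(3,4) by (auto simp: free_edges_def edges_def min_def max_def)
  qed
  moreover have "inj_on ?f (A - insert i (verts S))"
    by (rule inj_onI) (auto simp: min_def max_def split: if_splits)
  ultimately have "card (free_edges (edges A A) i S) = card (A - insert i (verts S))"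
    by (simp add: card_image)
  moreover have sub: "insert i (verts S) \<subseteq> A"
    using assms(2,3) verts_edges[of A A] verts_mono[of S "edges A A"] by (auto simp: matchings_def)
  moreover have "card (insert i (verts S)) = 2 * card S + 1"
    using assms(2,4) finite_subset[OF sub assms(1)] card_verts[of S] by (simp add: matchings_def)
  ultimately show ?thesis
    using card_mono[OF assms(1) sub] finite_subset[OF sub assms(1)] by (simp add: card_Diff_subset)
qed

section \<open>Reordering products in which only some factors commute\<close>

text \<open>The head of the second list is moved to the front of the first. It only passes elements
  that precede it there and follow it in the second list, so commutation is needed just for pairs on
  which the two orders disagree.\<close>

lemma fold_eq_sorted_wrt:
  assumes "sorted_wrt R xs" "sorted_wrt Q ys" "distinct xs" "distinct ys" "set xs = set ys"
    and "\<And>x y. x \<in> set xs \<Longrightarrow> y \<in> set xs \<Longrightarrow> R x y \<Longrightarrow> Q y x \<Longrightarrow> f x \<circ> f y = f y \<circ> f x"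
  shows "fold f xs = fold f ys"
  using assms
proof (induction ys arbitrary: xs)
  case (Cons y ys)
  then obtain us vs where xs: "xs = us @ y # vs" by (metis list.set_intros(1) split_list)
  have "f y \<circ> f u = f u \<circ> f y" if u: "u \<in> set us" for u
  proof -
    have "u \<noteq> y" "u \<in> set xs" "R u y" using Cons.prems(1,3) u by (auto simp: xs sorted_wrt_append)
    moreover from this have "Q y u" using Cons.prems(2,5) by auto
    moreover have "y \<in> set xs" by (simp add: xs)
    ultimately show ?thesis using Cons.prems(6)[of u y] by metis
  qed
  then have "f y \<circ> fold f us = fold f us \<circ> f y"
    by (intro fold_commute) (simp add: fun_eq_iff)
  then have "fold f xs = fold f (us @ vs) \<circ> f y"
    by (simp add: xs fun_eq_iff)
  also have "fold f (us @ vs) = fold f ys"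
  proof (rule Cons.IH)
    show "sorted_wrt R (us @ vs)" using Cons.prems(1) by (simp add: xs sorted_wrt_append)
    show "distinct (us @ vs)" using Cons.prems(3) by (simp add: xs)
    show "set (us @ vs) = set ys" using Cons.prems(3-5) by (auto simp: xs)
    show "f x \<circ> f z = f z \<circ> f x" if "x \<in> set (us @ vs)" "z \<in> set (us @ vs)" "R x z" "Q z x" for x z
      using that by (intro Cons.prems(6)) (simp_all add: xs)
  qed (use Cons.prems in auto)
  finally show ?case by (simp add: fun_eq_iff)
qed simp

lemma sorted_wrt_concat_map:
  assumes "sorted_wrt P xs" "\<And>x. x \<in> set xs \<Longrightarrow> sorted_wrt R (g x)"
    and "\<And>x y u v. x \<in> set xs \<Longrightarrow> y \<in> set xs \<Longrightarrow> P x y \<Longrightarrow> u \<in> set (g x) \<Longrightarrow> v \<in> set (g y) \<Longrightarrow> R u v"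
  shows "sorted_wrt R (concat (map g xs))"
  using assms
proof (induction xs)
  case (Cons x xs)
  have "sorted_wrt R (concat (map g xs))"
  proof (rule Cons.IH)
    show "R u v" if "y \<in> set xs" "z \<in> set xs" "P y z" "u \<in> set (g y)" "v \<in> set (g z)" for y z u v
      using that by (intro Cons.prems(3)[of y z]) simp_all
  qed (use Cons.prems in auto)
  moreover have "\<forall>u\<in>set (g x). \<forall>v\<in>set (concat (map g xs)). R u v"
    using Cons.prems(1) Cons.prems(3)[of x] by auto
  ultimately show ?case using Cons.prems(2)[of x] by (simp add: sorted_wrt_append)
qed simp

lemma sorted_wrt_irrefl_distinct: "sorted_wrt R xs \<Longrightarrow> (\<And>x. \<not> R x x) \<Longrightarrow> distinct xs"
  by (induction xs) auto

lemma R_til_commute: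
  assumes "i \<noteq> j" "k \<noteq> l" "{i, j} \<inter> {k, l} = {}"
  shows "R_til s n x i j (R_til s n y k l T) = R_til s n y k l (R_til s n x i j T)"
proof -
  have R: "R_til s n x p q U = (\<lambda>I. U I + (- inverse x) * P_til s n p q U I)" for x p q U
    by (simp add: R_til_def)
  show ?thesis
    unfolding R P_til_linear P_til_commute[OF assms] by (simp add: algebra_simps)
qed

section \<open>The product over one block of segments\<close>

text \<open>The bound \<open>q\<close> only matters when the two segments coincide.\<close>

definition block :: "nat \<Rightarrow> nat \<Rightarrow> nat \<Rightarrow> nat \<Rightarrow> (nat \<times> nat) list" where
  "block a0 la b0 lb =
     concat (map (\<lambda>q. map (\<lambda>p. (p, q)) [a0 + 1..<min (a0 + la + 1) q]) [b0 + 1..<b0 + lb + 1])"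

lemma set_block: "set (block a0 la b0 lb) = edges {a0 + 1..a0 + la} {b0 + 1..b0 + lb}"
  unfolding block_def edges_def by auto

text \<open>Here \<open>\<epsilon>\<close> is the number of vertices that an edge of a matching removes from the neighbours
  of a given vertex: both ends if the two segments coincide, one end otherwise.\<close>

lemma fold_R_til_block:
  assumes even: "s = Symp \<longrightarrow> even n"
    and cross: "\<epsilon> = 1 \<and> a0 + la \<le> b0 \<or> \<epsilon> = (2 :: nat) \<and> a0 = b0 \<and> la = lb"
    and A: "A = {a0 + 1..a0 + la}" and B: "B = {b0 + 1..b0 + lb}"
    and skewA: "\<And>p q. p \<in> A \<Longrightarrow> q \<in> A \<Longrightarrow> p \<noteq> q \<Longrightarrow> skew p q T"
    and skewB: "\<And>p q. p \<in> B \<Longrightarrow> q \<in> B \<Longrightarrow> p \<noteq> q \<Longrightarrow> skew p q T"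
    and supp: "\<And>p. p \<in> A \<union> B \<Longrightarrow> supported n p T"
    and x: "\<And>i j. i \<in> {1..la} \<Longrightarrow> j \<in> {1..lb} \<Longrightarrow> x (a0 + i) (b0 + j) = of_nat (i + j) - 1 - L"
    and L: "L \<notin> \<int>"
    and c0: "c 0 = 1" and c: "\<And>k. c k = (L - of_nat (\<epsilon> * Suc k)) * c (Suc k)"
  shows "fold (\<lambda>(p, q). R_til s n (x p q) p q) (block a0 la b0 lb) T = match_sum s n c (edges A B) T"
proof -
  \<comment> \<open>The edges of the first \<open>j\<close> columns; the induction adds one column
    at a time.\<close>
  define E where "E j = edges A {b0 + 1..b0 + j}" for j
  have ltE: "k < l" if "(k, l) \<in> E j" for k l j using that by (simp add: E_def edges_def)
  have finE: "finite (E j)" for j by (simp add: E_def finite_edges A)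
  have L_nat: "of_nat k \<noteq> L" for k using L by (metis Ints_of_nat)
  have "fold (\<lambda>(p, q). R_til s n (x p q) p q) (block a0 la b0 j) T = match_sum s n c (E j) T"
    if "j \<le> lb" for j
    using that
  proof (induction j)
    case 0
    have "matchings (E 0) = {{}}"
      using matching_empty by (auto simp: matchings_def E_def edges_def)
    then show ?case by (simp add: block_def match_sum_def c0 P_prod_empty)
  next
    case (Suc j)
    define q where "q = b0 + Suc j"
    define ps where "ps = [a0 + 1..<min (a0 + la + 1) q]"
    define U where "U = match_sum s n c (E j) T"
    \<comment> \<open>The factor number \<open>k\<close>, counted from 0, of this column has row
      \<open>Suc k\<close> and column \<open>Suc j\<close>, so its parameter is
      \<open>Suc k + Suc j - 1 - L = k - d\<close>, as \<open>fold_R_til_column\<close>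
      requires.\<close>
    define d where "d = L - of_nat (Suc j)"
    have qB: "q \<in> B" using Suc.prems by (simp add: q_def B)
    have J: "p \<in> set ps \<longleftrightarrow> p \<in> A \<and> p < q" for p by (auto simp: ps_def A)
    \<comment> \<open>For distinct segments \<open>ps\<close> lists all of \<open>A\<close>; in a
      diagonal block it lists just the columns treated before, and \<open>A\<close> can be cut down
      to them.\<close>
    have E_eq: "E j = edges (set ps) {b0 + 1..b0 + j} \<and>
        (set ps = {b0 + 1..b0 + j} \<or> (\<forall>k\<in>set ps. \<forall>l\<in>{b0 + 1..b0 + j}. k < l))"
      using cross
    proof
      assume "\<epsilon> = 1 \<and> a0 + la \<le> b0"
      then show ?thesis by (auto simp: E_def edges_def ps_def A q_def)
    next
      assume *: "\<epsilon> = 2 \<and> a0 = b0 \<and> la = lb"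
      then have "set ps = {b0 + 1..b0 + j}" using Suc.prems by (auto simp: ps_def q_def)
      moreover have "E j = edges {b0 + 1..b0 + j} {b0 + 1..b0 + j}"
        using * Suc.prems by (auto simp: E_def edges_def A)
      ultimately show ?thesis by simp
    qed
    have vertsE: "verts (E j) \<subseteq> A \<union> {b0 + 1..b0 + j}"
      unfolding E_def by (rule verts_edges)
    have skewU: "skew u v U" if "u \<in> set ps" "v \<in> set ps" "u \<noteq> v" for u v
      unfolding U_def
    proof (rule skew_match_sum[OF even])
      \<comment> \<open>In a diagonal block all rows of the new column are earlier columns; for
        distinct segments none of them is.\<close>
      have "u \<in> {b0 + 1..b0 + j} \<longleftrightarrow> v \<in> {b0 + 1..b0 + j}"
        using E_eq that by fastforce
      then show "relabel (transpose u v) (E j) \<subseteq> E j"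
        using E_eq that by (metis relabel_edges)
    qed (use that J skewA in blast)
    have fold_ps: "fold (\<lambda>p. R_til s n (x p q) p q) ps U
        = (\<lambda>I. U I + inverse d * (\<Sum>p\<in>set ps. P_til s n p q U I))"
    proof (rule fold_R_til_column)
      show "distinct ps" by (simp add: ps_def)
      show "q \<notin> set ps" by (simp add: J)
      show "supported n p U" if "p \<in> set ps" for p
        using supp that by (simp add: U_def supported_match_sum J)
      show "x (ps ! k) q = of_nat k - d \<and> of_nat k \<noteq> d" if k: "k < length ps" for k
      proof
        have "a0 + 1 + k < min (a0 + la + 1) q" using k unfolding ps_def length_upt by linarith
        then have "ps ! k = a0 + Suc k" "Suc k \<in> {1..la}" by (simp_all add: ps_def nth_upt)
        then show "x (ps ! k) q = of_nat k - d"
          using x[of "Suc k" "Suc j"] Suc.prems by (simp add: q_def d_def)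
        show "of_nat k \<noteq> d"
          using L_nat[of "k + Suc j"] by (auto simp: d_def algebra_simps)
      qed
    qed (use even skewU in auto)
    have "d \<noteq> 0" using L_nat[of "Suc j"] by (auto simp: d_def)
    have E_Suc: "E (Suc j) = E j \<union> (\<lambda>i. (i, q)) ` set ps"
      by (auto simp: E_def edges_def J q_def)
    have "match_sum s n c (E j \<union> (\<lambda>i. (i, q)) ` set ps) T
        = (\<lambda>I. U I + inverse d * (\<Sum>i\<in>set ps. P_til s n i q U I))"
      unfolding U_def
    proof (rule match_sum_add_column)
      show "q \<notin> verts (E j)"
        using vertsE cross Suc.prems by (auto simp: E_eq q_def verts_def edges_def ps_def)
      \<comment> \<open>A neighbour \<open>u\<close> of \<open>i\<close> lies in \<open>B\<close>,
        as \<open>q\<close> does, in both kinds of block.\<close>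
      show "skew u q T" if i: "i \<in> set ps" and u: "(i, u) \<in> E j \<or> (u, i) \<in> E j" for i u
        using cross
      proof
        assume "\<epsilon> = 1 \<and> a0 + la \<le> b0"
        then have "u \<in> {b0 + 1..b0 + j}" using i u by (auto simp: E_def edges_def J A)
        then show ?thesis using qB Suc.prems by (intro skewB) (auto simp: B q_def)
      next
        assume "\<epsilon> = 2 \<and> a0 = b0 \<and> la = lb"
        moreover have "u \<in> set ps \<union> {b0 + 1..b0 + j}" using u E_eq by (auto simp: edges_def)
        ultimately show ?thesis using qB by (intro skewB) (auto simp: ps_def B q_def)
      qed
      show "c (card S) - of_nat (card (free_edges (E j) i S)) * c (Suc (card S)) = d * c (Suc (card S))"
        if i: "i \<in> set ps" and S: "S \<in> matchings (E j)" "i \<notin> verts S" for i S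
      proof -
        \<comment> \<open>Written with \<open>Suc\<close>, the two counts take one shape. With the
          recursion for \<open>c\<close> it gives the factor \<open>L - Suc j = d\<close>,
          independent of \<open>i\<close> and \<open>S\<close>.\<close>
        have "card (free_edges (E j) i S) + \<epsilon> * Suc (card S) = Suc j"
          using cross
        proof
          assume *: "\<epsilon> = 1 \<and> a0 + la \<le> b0"
          then have "card (free_edges (E j) i S) + card S = card {b0 + 1..b0 + j}"
            using i S unfolding E_def
            by (intro card_free_edges_cross) (auto simp: A J)
          then show ?thesis using * by simp
        next
          assume *: "\<epsilon> = 2 \<and> a0 = b0 \<and> la = lb"
          have ps: "set ps = {b0 + 1..b0 + j}" using * Suc.prems by (auto simp: ps_def q_def)
          then have "card (free_edges (E j) i S) + 2 * card S + 1 = card {b0 + 1..b0 + j}"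
            using i S E_eq by (metis card_free_edges_self finite_set)
          then show ?thesis using * by simp
        qed
        then have "of_nat (card (free_edges (E j) i S)) + of_nat (\<epsilon> * Suc (card S)) = (of_nat (Suc j) :: complex)"
          by (metis of_nat_add)
        then have "L - of_nat (\<epsilon> * Suc (card S)) - of_nat (card (free_edges (E j) i S)) = d"
          unfolding d_def by (simp only: algebra_simps)
        then show ?thesis
          unfolding c[of "card S"] by (simp only: left_diff_distrib[symmetric])
      qed
    qed (use finE ltE even supp qB \<open>d \<noteq> 0\<close> J in auto)
    moreover have "fold (\<lambda>(p, q). R_til s n (x p q) p q) (block a0 la b0 (Suc j)) T
        = fold (\<lambda>p. R_til s n (x p q) p q) ps U"
    proof -
      have "block a0 la b0 (Suc j) = block a0 la b0 j @ map (\<lambda>p. (p, q)) ps"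
        by (simp add: block_def ps_def q_def)
      then show ?thesis
        using Suc by (simp add: U_def fold_map comp_def)
    qed
    ultimately show ?case by (simp add: E_Suc fold_ps)
  qed
  then show ?thesis by (simp add: E_def B)
qed

section \<open>The operators \<open>G_op\<close> as sums over matchings\<close>

text \<open>The edges of a matching have distinct first ends. This is why the sum over
  \<open>d\<close> in \<open>G_op\<close> may stop at \<open>nu a\<close>.\<close>

lemma matchings_edges_card:
  assumes "finite A" "S \<in> matchings (edges A B)"
  shows "card S \<le> card A"
proof -
  have S: "S \<subseteq> A \<times> B" "matching S" using assms(2) by (auto simp: matchings_def edges_def)
  have "inj_on fst S"
  proof (rule inj_onI)
    fix e e' assume e: "e \<in> S" "e' \<in> S" "fst e = fst e'"
    show "e = e'"
    proof (rule ccontr)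
      assume "e \<noteq> e'"
      then have "case e of (i, j) \<Rightarrow> case e' of (k, l) \<Rightarrow> {i, j} \<inter> {k, l} = {}"
        using S(2) e(1,2) unfolding matching_def pairwise_def by fastforce
      then show False using e(3) by (cases e; cases e') simp
    qed
  qed
  moreover have "fst ` S \<subseteq> A" using S(1) by auto
  ultimately show ?thesis using assms(1) by (rule card_inj_on_le)
qed

text \<open>Matchings are grouped by their number of edges; the leading \<open>T\<close> in
  \<open>G_op\<close> is the term of the empty matching.\<close>

lemma G_op_eq_match_sum:
  assumes "\<not> (a = b \<and> s = Orth)"
  shows "G_op s n nu lam a b T = match_sum s n (\<lambda>d. \<Prod>k=1..d. inverse (G_denom s lam a b k))
    (edges (segment nu a) (segment nu b)) T"
proof
  fix I
  let ?F = "edges (segment nu a) (segment nu b)"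
  let ?c = "\<lambda>d. \<Prod>k=1..d. inverse (G_denom s lam a b k)"
  have fin: "finite ?F" by (intro finite_edges) (simp_all add: segment_def)
  have pair: "{S \<in> matchings ?F. card S = d} = pair_sets nu a b d" for d
    using fin by (auto simp: matchings_def pair_sets_def matching_def edges_def intro: finite_subset)
  have "match_sum s n ?c ?F T I
      = (\<Sum>d\<in>{0..nu a}. \<Sum>S | S \<in> matchings ?F \<and> card S = d. ?c (card S) * P_prod s n S T I)"
    unfolding match_sum_def
  proof (rule sum.group[symmetric])
    show "card ` matchings ?F \<subseteq> {0..nu a}"
      using matchings_edges_card[of "segment nu a" _ "segment nu b"] by (auto simp: segment_def)
  qed (use fin in \<open>auto intro: finite_matchings\<close>)
  also have "\<dots> = (\<Sum>d\<in>{0..nu a}. \<Sum>S\<in>pair_sets nu a b d. ?c d * P_prod s n S T I)"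
    by (intro sum.cong) (auto simp: pair[symmetric])
  also have "\<dots> = (\<Sum>S\<in>pair_sets nu a b 0. P_prod s n S T I)
      + (\<Sum>d=1..nu a. \<Sum>S\<in>pair_sets nu a b d. ?c d * P_prod s n S T I)"
    by (simp add: sum.atLeast_Suc_atMost)
  also have "pair_sets nu a b 0 = {{}}"
    using fin matching_empty by (auto simp: pair[symmetric] matchings_def matching_def)
  finally show "G_op s n nu lam a b T I = match_sum s n ?c ?F T I"
    using assms by (auto simp: G_op_def P_prod_empty)
qed

section \<open>Segments and the regrouping of the product into blocks\<close>

lemma seg_of_segment:
  assumes "1 \<le> a" "p \<in> segment nu a"
  shows "seg_of nu p = a"
  unfolding seg_of_def
proof (rule Least_equality)
  show "1 \<le> a \<and> p \<le> seg_start nu a + nu a"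
    using assms by (simp add: segment_def)
next
  fix b assume b: "1 \<le> b \<and> p \<le> seg_start nu b + nu b"
  show "a \<le> b"
  proof (rule ccontr)
    assume "\<not> a \<le> b"
    then have "seg_start nu (Suc b) \<le> seg_start nu a"
      by (intro seg_start_mono) simp
    then show False
      using b assms seg_start_Suc[of b nu] by (simp add: segment_def)
  qed
qed

lemma segment_exists:
  assumes "1 \<le> p" "p \<le> seg_start nu (Suc m)"
  shows "\<exists>a\<in>{1..m}. p \<in> segment nu a"
  using assms
proof (induction m)
  case (Suc m)
  show ?case
  proof (cases "p \<le> seg_start nu (Suc m)")
    case True
    then show ?thesis using Suc by fastforce
  next
    case False
    then show ?thesis
      using Suc.prems seg_start_Suc[of "Suc m" nu] by (auto simp: segment_def intro!: bexI[of _ "Suc m"])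
  qed
qed (simp add: seg_start_def)

lemma segment_less:
  assumes "1 \<le> a" "a < b" "p \<in> segment nu a" "q \<in> segment nu b"
  shows "p < q"
  using seg_start_mono[of "Suc a" b nu] seg_start_Suc[of a nu] assms by (auto simp: segment_def)

text \<open>The order in which the concatenated blocks list the index pairs: blocks by the two
  segments, then columns, then rows.\<close>

definition block_order :: "(nat \<Rightarrow> nat) \<Rightarrow> nat \<times> nat \<Rightarrow> nat \<times> nat \<Rightarrow> bool" where
  "block_order f = (\<lambda>(p, q) (p', q'). f p < f p' \<or> f p = f p' \<and>
     (f q < f q' \<or> f q = f q' \<and> (q < q' \<or> q = q' \<and> p < p')))"

text \<open>Since \<open>seg_of\<close> is nondecreasing, index pairs with a common position stand
  in the same order in both lists. Only disjoint pairs change places, and their factors commute by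
  \<open>R_til_commute\<close>.\<close>

lemma C_op_eq_fold_blocks:
  "C_op s n m nu mu = fold (\<lambda>(p, q). R_til s n (of_nat n - x_val s nu mu p - x_val s nu mu q) p q)
     (concat (map (\<lambda>(a, b). block (seg_start nu a) (nu a) (seg_start nu b) (nu b))
       [(a, b). a \<leftarrow> [1..<m + 1], b \<leftarrow> [a..<m + 1]]))"
proof -
  let ?N = "seg_start nu (Suc m)" and ?f = "seg_of nu"
  let ?lex = "\<lambda>(p, q) (p', q'). p < p' \<or> p = p' \<and> q < (q' :: nat)"
  let ?xs = "[(p, q). p \<leftarrow> [1..<?N + 1], q \<leftarrow> [p + 1..<?N + 1]]"
  let ?ab = "[(a, b). a \<leftarrow> [1..<m + 1], b \<leftarrow> [a..<m + 1]]"
  let ?blk = "\<lambda>(a, b). block (seg_start nu a) (nu a) (seg_start nu b) (nu b)"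
  let ?R = "\<lambda>(p, q). R_til s n (of_nat n - x_val s nu mu p - x_val s nu mu q) p q"
  have N: "(\<Sum>a=1..m. nu a) = ?N"
    by (simp add: seg_start_def atLeastLessThanSuc_atLeastAtMost)
  have blk: "(p, q) \<in> set (?blk (a, b)) \<longleftrightarrow> p \<in> segment nu a \<and> q \<in> segment nu b \<and> p < q" for p q a b
    by (auto simp: set_block edges_def segment_def)
  have ab: "(a, b) \<in> set ?ab \<longleftrightarrow> 1 \<le> a \<and> a \<le> b \<and> b \<le> m" for a b
    by (auto simp: image_iff)
  have "fold ?R ?xs = fold ?R (concat (map ?blk ?ab))"
  proof (rule fold_eq_sorted_wrt)
    show sx: "sorted_wrt ?lex ?xs"
      by (rule sorted_wrt_concat_map[of "(<)"]) (auto simp: sorted_wrt_map simp del: upt_Suc)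
    show "distinct ?xs" by (rule sorted_wrt_irrefl_distinct[OF sx]) auto
    have sab: "sorted_wrt ?lex ?ab"
      by (rule sorted_wrt_concat_map[of "(<)"]) (auto simp: sorted_wrt_map simp del: upt_Suc)
    show sy: "sorted_wrt (block_order ?f) (concat (map ?blk ?ab))"
    proof (rule sorted_wrt_concat_map[OF sab])
      fix e assume e_in: "e \<in> set ?ab"
      obtain a b where e: "e = (a, b)" by (cases e)
      have ab': "1 \<le> a" "a \<le> b" using e_in unfolding e ab by blast+
      have fa: "?f p = a" if "p \<in> {seg_start nu a + 1..<seg_start nu a + nu a + 1}" for p
        using that ab' by (intro seg_of_segment) (auto simp: segment_def)
      have fb: "?f p = b" if "p \<in> {seg_start nu b + 1..<seg_start nu b + nu b + 1}" for p
        using that ab' by (intro seg_of_segment) (auto simp: segment_def)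
      have "sorted_wrt (block_order ?f) (block (seg_start nu a) (nu a) (seg_start nu b) (nu b))"
        unfolding block_def
      proof (rule sorted_wrt_concat_map[OF sorted_wrt_upt])
        fix q assume "q \<in> set [seg_start nu b + 1..<seg_start nu b + nu b + 1]"
        show "sorted_wrt (block_order ?f)
            (map (\<lambda>p. (p, q)) [seg_start nu a + 1..<min (seg_start nu a + nu a + 1) q])"
          unfolding sorted_wrt_map
          by (rule sorted_wrt_mono_rel[OF _ sorted_wrt_upt]) (auto simp: block_order_def fa)
      qed (auto simp: block_order_def fa fb)
      then show "sorted_wrt (block_order ?f) (?blk e)" by (simp add: e)
    next
      fix e e' u v assume e_in: "e \<in> set ?ab" "e' \<in> set ?ab" and less: "?lex e e'"
        and uv: "u \<in> set (?blk e)" "v \<in> set (?blk e')"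
      obtain a b a' b' p q p' q' where eq: "e = (a, b)" "e' = (a', b')" "u = (p, q)" "v = (p', q')"
        by (cases e, cases e', cases u, cases v)
      have "1 \<le> a" "a \<le> b" "1 \<le> a'" "a' \<le> b'"
        using e_in unfolding eq ab by blast+
      moreover have "p \<in> segment nu a" "q \<in> segment nu b" "p' \<in> segment nu a'" "q' \<in> segment nu b'"
        using uv unfolding eq blk by blast+
      ultimately have "?f p = a" "?f q = b" "?f p' = a'" "?f q' = b'"
        by (auto intro!: seg_of_segment)
      then show "block_order ?f u v" using less by (auto simp: eq block_order_def)
    qed
    show "distinct (concat (map ?blk ?ab))"
      by (rule sorted_wrt_irrefl_distinct[OF sy]) (auto simp: block_order_def)
    have in_xs: "(p, q) \<in> set ?xs \<longleftrightarrow> 1 \<le> p \<and> p < q \<and> q \<le> ?N" for p q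
      by (auto simp: image_iff)
    have in_ys: "(p, q) \<in> set (concat (map ?blk ?ab)) \<longleftrightarrow>
        (\<exists>a b. 1 \<le> a \<and> a \<le> b \<and> b \<le> m \<and> p \<in> segment nu a \<and> q \<in> segment nu b \<and> p < q)" for p q
    proof -
      have "(p, q) \<in> set (concat (map ?blk ?ab)) \<longleftrightarrow>
          (\<exists>a b. (a, b) \<in> set ?ab \<and> (p, q) \<in> set (?blk (a, b)))"
        by (simp only: set_concat[of "map ?blk ?ab"] set_map[of ?blk] UN_iff image_iff bex_simps Bex_def split_paired_Ex)
           blast
      then show ?thesis unfolding ab blk by blast
    qed
    show "set ?xs = set (concat (map ?blk ?ab))"
    proof (rule set_eqI)
      fix e :: "nat \<times> nat"
      obtain p q where e: "e = (p, q)" by (cases e)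
      have "(p, q) \<in> set ?xs \<longleftrightarrow> (p, q) \<in> set (concat (map ?blk ?ab))"
      proof
        assume "(p, q) \<in> set ?xs"
        then have pq: "1 \<le> p" "p < q" "q \<le> ?N" using in_xs by auto
        then have "p \<le> ?N" "1 \<le> q" by linarith+
        then obtain a b where a: "a \<in> {1..m}" "p \<in> segment nu a" and b: "b \<in> {1..m}" "q \<in> segment nu b"
          using segment_exists[of p nu m] segment_exists[of q nu m] pq by blast
        have "a \<le> b"
          using segment_less[of b a q nu p] a b pq(2) by fastforce
        then show "(p, q) \<in> set (concat (map ?blk ?ab))"
          unfolding in_ys using a b pq(2) by auto
      next
        assume "(p, q) \<in> set (concat (map ?blk ?ab))"
        then obtain a b where "1 \<le> a" "a \<le> b" "b \<le> m" "p \<in> segment nu a" "q \<in> segment nu b" "p < q"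
          unfolding in_ys by blast
        then show "(p, q) \<in> set ?xs"
          unfolding in_xs using seg_start_mono[of "Suc b" "Suc m" nu] seg_start_Suc[of b nu]
          by (auto simp: segment_def)
      qed
      then show "e \<in> set ?xs \<longleftrightarrow> e \<in> set (concat (map ?blk ?ab))" by (simp only: e)
    qed
    fix u v assume uv: "u \<in> set ?xs" "v \<in> set ?xs" "?lex u v" "block_order ?f v u"
    obtain p q p' q' where eq: "u = (p, q)" "v = (p', q')" by (cases u, cases v)
    have mono: "?f k \<le> ?f l" if kl: "1 \<le> k" "k \<le> l" "l \<le> ?N" for k l
    proof -
      have "1 \<le> l" "k \<le> ?N" using kl by linarith+
      then obtain a b where a: "a \<in> {1..m}" "k \<in> segment nu a" and b: "b \<in> {1..m}" "l \<in> segment nu b"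
        using segment_exists[of k nu m] segment_exists[of l nu m] kl(1,3) by blast
      have "a \<le> b" using segment_less[of b a l nu k] a b kl(2) by fastforce
      then show ?thesis using a b seg_of_segment[of a k nu] seg_of_segment[of b l nu] by auto
    qed
    have pq: "1 \<le> p" "p < q" "q \<le> ?N" "1 \<le> p'" "p' < q'" "q' \<le> ?N"
      using uv(1,2) in_xs by (auto simp: eq)
    have "{p, q} \<inter> {p', q'} = {}"
    proof (cases "p = p'")
      case True
      then show ?thesis
        using uv(3,4) pq mono[of q q'] by (auto simp: eq block_order_def)
    next
      case False
      then have "p < p'" using uv(3) by (auto simp: eq)
      moreover from this have "?f p \<le> ?f p'" using mono[of p p'] pq by simp
      ultimately have "?f p' = ?f p" and "?f q' < ?f q \<or> ?f q' = ?f q \<and> q' < q \<or> ?f q' = ?f q \<and> q' = q \<and> p' < p"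
        using uv(4) by (auto simp: eq block_order_def)
      \<comment> \<open>What remains is the nested case \<open>p < p' < q' < q\<close>.\<close>
      then show ?thesis
        using \<open>p < p'\<close> pq mono[of p' q'] by auto
    qed
    then show "?R u \<circ> ?R v = ?R v \<circ> ?R u"
      using pq R_til_commute[of p q p' q'] by (simp add: eq fun_eq_iff)
  qed
  then show ?thesis unfolding C_op_def N Let_def .
qed

section \<open>Assembling the blocks\<close>

text \<open>The invariant carried from one block to the next: what the block computation uses of
  \<open>exterior_space\<close>.\<close>

definition segmentwise_skew :: "nat \<Rightarrow> nat \<Rightarrow> (nat \<Rightarrow> nat) \<Rightarrow> tensor \<Rightarrow> bool" where
  "segmentwise_skew n m nu T \<longleftrightarrow> (\<forall>a\<in>{1..m}. \<forall>p\<in>segment nu a.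
     supported n p T \<and> (\<forall>q\<in>segment nu a. p \<noteq> q \<longrightarrow> skew p q T))"

lemma exterior_space_segmentwise_skew:
  assumes "T \<in> exterior_space n m nu"
  shows "segmentwise_skew n m nu T"
  unfolding segmentwise_skew_def
proof (intro ballI conjI impI)
  fix a p assume a: "a \<in> {1..m}" and p: "p \<in> segment nu a"
  have "p \<in> {1..\<Sum>a=1..m. nu a}"
    using seg_start_mono[of "Suc a" "Suc m" nu] seg_start_Suc[of a nu] a p
    by (auto simp: segment_def seg_start_def atLeastLessThanSuc_atLeastAtMost)
  then show "supported n p T"
    using assms unfolding exterior_space_def tensor_space_def supported_def by (blast dest: PiE_mem)
  fix q assume "q \<in> segment nu a" "p \<noteq> q"
  then have "T (I(p := I q, q := I p)) = - T I" for I
    using assms a p unfolding exterior_space_def by blast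
  then show "skew p q T"
    by (simp add: skew_def flip_def comp_transpose_upd)
qed

text \<open>A transposition inside one segment preserves every segment, hence the edge set of every
  block, so that \<open>skew_match_sum\<close> applies.\<close>

lemma segmentwise_skew_G_op:
  assumes "s = Symp \<longrightarrow> even n" "1 \<le> a" "a \<le> b" "segmentwise_skew n m nu T"
  shows "segmentwise_skew n m nu (G_op s n nu lam a b T)"
proof (cases "a = b \<and> s = Orth")
  case True
  then show ?thesis using assms(4) by (simp add: G_op_def)
next
  case False
  show ?thesis
    unfolding segmentwise_skew_def G_op_eq_match_sum[OF False]
  proof (intro ballI conjI impI)
    fix c p assume c: "c \<in> {1..m}" and p: "p \<in> segment nu c"
    show "supported n p (match_sum s n (\<lambda>d. \<Prod>k=1..d. inverse (G_denom s lam a b k))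
        (edges (segment nu a) (segment nu b)) T)"
      using assms(4) c p by (auto simp: segmentwise_skew_def intro: supported_match_sum)
    fix q assume q: "q \<in> segment nu c" "p \<noteq> q"
    have "u \<in> segment nu d \<longleftrightarrow> d = c" if "u \<in> segment nu c" "1 \<le> d" for u d
      using seg_of_segment[of d u nu] seg_of_segment[of c u nu] c that by auto
    then have mem: "p \<in> segment nu d \<longleftrightarrow> q \<in> segment nu d" if "1 \<le> d" for d
      using p q(1) that by blast
    show "skew p q (match_sum s n (\<lambda>d. \<Prod>k=1..d. inverse (G_denom s lam a b k))
        (edges (segment nu a) (segment nu b)) T)"
    proof (rule skew_match_sum[OF assms(1)])
      have "segment nu a = segment nu b \<or> (\<forall>u\<in>segment nu a. \<forall>v\<in>segment nu b. u < v)"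
        using assms(2,3) segment_less[of a b _ nu] by (cases "a = b") auto
      then show "relabel (transpose p q) (edges (segment nu a) (segment nu b)) \<subseteq> edges (segment nu a) (segment nu b)"
        using mem assms(2,3) by (intro relabel_edges) auto
      show "skew p q T"
        using assms(4) c p q by (auto simp: segmentwise_skew_def)
    qed
  qed
qed

theorem proposition3p3:
  fixes s :: series and n m :: nat and nu :: "nat \<Rightarrow> nat" and mu lam :: "nat \<Rightarrow> complex"
  assumes "n \<ge> 2"
    and "s = Symp \<longrightarrow> even n"
    and "m \<ge> 1"
    and "\<And>a. a \<in> {1..m} \<Longrightarrow> nu a \<in> {1..n - 1}"
    and "generic m mu"
    and "\<And>a. a \<in> {1..m} \<Longrightarrow> lam a = mu a + of_nat (nu a) - of_nat n / 2"
  shows "\<forall>T \<in> exterior_space n m nu. C_op s n m nu mu T = G_prod s n m nu lam T"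
proof
  fix T assume T: "T \<in> exterior_space n m nu"
  let ?x = "\<lambda>p q. of_nat n - x_val s nu mu p - x_val s nu mu q"
  let ?R = "\<lambda>(p, q). R_til s n (?x p q) p q"
  let ?blk = "\<lambda>(a, b). block (seg_start nu a) (nu a) (seg_start nu b) (nu b)"
  have block_eq: "fold ?R (?blk (a, b)) U = G_op s n nu lam a b U"
    if ab: "1 \<le> a" "a \<le> b" "b \<le> m" and U: "segmentwise_skew n m nu U" for a b U
  proof -
    have skewU: "skew p q U" if "p \<in> segment nu d" "q \<in> segment nu d" "p \<noteq> q" "d \<in> {a, b}" for p q d
    proof -
      have "d \<in> {1..m}" using ab that(4) by auto
      then show ?thesis using U that(1-3) unfolding segmentwise_skew_def by blast
    qed
    have suppU: "supported n p U" if "p \<in> segment nu a \<union> segment nu b" for p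
      using U ab that unfolding segmentwise_skew_def by auto
    show ?thesis
    proof (cases "a = b \<and> s = Orth")
      case True
      \<comment> \<open>Every factor of the block fixes \<open>U\<close>, so no intermediate tensors
        have to be followed.\<close>
      have "fold ?R es U = U" if "set es \<subseteq> edges (segment nu a) (segment nu a)" for es
        using that
      proof (induction es)
        case (Cons e es)
        then obtain p q where e: "e = (p, q)" "p \<noteq> q" "p \<in> segment nu a" "q \<in> segment nu a"
          by (cases e) (auto simp: edges_def)
        then have "P_til s n p q U = (\<lambda>I. 0)"
          using True skewU[of p a q] P_til_Orth_skew[of p q U] by simp
        then show ?case using Cons e by (simp add: R_til_def)
      qed simp
      then show ?thesis using True by (simp add: G_op_def set_block segment_def)
    next
      case False
      \<comment> \<open>With this \<open>L\<close> the denominators are \<open>L - k\<close> off the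
        diagonal and \<open>L - 2 * k\<close> on it, which explains
        \<open>\<epsilon>\<close>.\<close>
      define L where "L = lam a + lam b + rho s a + rho s b"
      define \<epsilon> :: nat where "\<epsilon> = (if a = b then 2 else 1)"
      have denom: "G_denom s lam a b k = L - of_nat (\<epsilon> * k)" for k
        by (simp add: G_denom_def L_def \<epsilon>_def)
      \<comment> \<open>The two halves of \<open>n\<close> add up to an integer, so genericity of
        \<open>mu\<close> passes to \<open>L\<close> and no denominator vanishes.\<close>
      have "L - (mu a + mu b) \<in> \<int>"
      proof -
        have "L - (mu a + mu b) = of_nat (nu a) + of_nat (nu b) - of_nat n + rho s a + rho s b"
          using assms(6)[of a] assms(6)[of b] ab by (simp add: L_def)
        moreover have "rho s c \<in> \<int>" for c by (simp add: rho_def split: series.split)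
        ultimately show ?thesis by simp
      qed
      moreover have "mu a + mu b \<notin> \<int>"
        using assms(5) ab by (cases "a = b") (auto simp: generic_def mult_2[symmetric])
      ultimately have L: "L \<notin> \<int>"
        by (metis Ints_diff diff_diff_eq2 add_diff_cancel_left')
      have "fold ?R (?blk (a, b)) U = match_sum s n (\<lambda>d. \<Prod>k=1..d. inverse (G_denom s lam a b k))
          (edges (segment nu a) (segment nu b)) U"
        unfolding prod.case
      proof (rule fold_R_til_block[where \<epsilon> = \<epsilon> and L = L])
        show "\<epsilon> = 1 \<and> seg_start nu a + nu a \<le> seg_start nu b \<or>
            \<epsilon> = 2 \<and> seg_start nu a = seg_start nu b \<and> nu a = nu b"
          using ab seg_start_mono[of "Suc a" b nu] seg_start_Suc[of a nu] by (auto simp: \<epsilon>_def)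
        show "?x (seg_start nu a + i) (seg_start nu b + j) = of_nat (i + j) - 1 - L"
          if "i \<in> {1..nu a}" "j \<in> {1..nu b}" for i j
        proof -
          have lam: "lam a = mu a + of_nat (nu a) - of_nat n / 2" "lam b = mu b + of_nat (nu b) - of_nat n / 2"
            using ab by (auto intro: assms(6))
          \<comment> \<open>Here \<open>mu a + nu a + 1 / 2 = lam a + (n + 1) / 2\<close>; two such
            terms contribute \<open>n + 1\<close>, which leaves the \<open>- 1\<close> after
            subtraction from \<open>n\<close>.\<close>
          have "x_val s nu mu (seg_start nu a + i) = lam a + rho s a + (of_nat n + 1) / 2 - of_nat i"
            using that ab by (subst x_val_eq) (simp_all add: lam field_simps)
          moreover have "x_val s nu mu (seg_start nu b + j) = lam b + rho s b + (of_nat n + 1) / 2 - of_nat j"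
            using that ab by (subst x_val_eq) (simp_all add: lam field_simps)
          ultimately show ?thesis by (simp add: L_def)
        qed
        show "(\<Prod>k=1..d. inverse (G_denom s lam a b k))
            = (L - of_nat (\<epsilon> * Suc d)) * (\<Prod>k=1..Suc d. inverse (G_denom s lam a b k))" for d
        proof -
          have ne: "L - of_nat (\<epsilon> * Suc d) \<noteq> 0" using L by (metis Ints_of_nat eq_iff_diff_eq_0)
          have "(\<Prod>k=1..Suc d. inverse (G_denom s lam a b k))
              = inverse (L - of_nat (\<epsilon> * Suc d)) * (\<Prod>k=1..d. inverse (G_denom s lam a b k))"
            unfolding denom by (simp only: prod.nat_ivl_Suc' mult.commute)
          then show ?thesis by (simp only: mult.assoc[symmetric] right_inverse[OF ne] mult_1)
        qed
      qed (use assms(2) L skewU suppU in \<open>auto simp: segment_def\<close>)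
      then show ?thesis by (simp only: G_op_eq_match_sum[OF False])
    qed
  qed
  \<comment> \<open>\<open>U\<close> is arbitrary because each block acts on the output of the
    previous ones, which is still segmentwise skew.\<close>
  have blocks_eq: "fold ?R (concat (map ?blk es)) U = fold (\<lambda>(a, b). G_op s n nu lam a b) es U"
    if "\<And>a b. (a, b) \<in> set es \<Longrightarrow> 1 \<le> a \<and> a \<le> b \<and> b \<le> m" "segmentwise_skew n m nu U" for es U
    using that
  proof (induction es arbitrary: U)
    case (Cons e es)
    obtain a b where e: "e = (a, b)" by (cases e)
    have ab: "1 \<le> a" "a \<le> b" "b \<le> m" using Cons.prems(1)[of a b] by (simp_all add: e)
    have "segmentwise_skew n m nu (G_op s n nu lam a b U)"
      using assms(2) ab Cons.prems(2) by (intro segmentwise_skew_G_op)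
    then have "fold ?R (concat (map ?blk es)) (G_op s n nu lam a b U)
        = fold (\<lambda>(a, b). G_op s n nu lam a b) es (G_op s n nu lam a b U)"
      using Cons.prems(1) by (intro Cons.IH) auto
    moreover have "fold ?R (concat (map ?blk (e # es))) U
        = fold ?R (concat (map ?blk es)) (fold ?R (?blk (a, b)) U)"
      by (simp add: e)
    ultimately show ?case
      unfolding block_eq[OF ab Cons.prems(2)] by (simp add: e)
  qed simp
  show "C_op s n m nu mu T = G_prod s n m nu lam T"
    unfolding C_op_eq_fold_blocks G_prod_def
    by (rule blocks_eq[OF _ exterior_space_segmentwise_skew[OF T]]) auto
qed

end
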